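(* If $G$ is a planar graph with maximum degree $\Delta$ that contains no $4$-cycles and no $5$-cycles, then there exists an ordering $v_1, \ldots, v_n$ of $V(G)$ such that each $v_i$ has at most $3$ neighbors in $G$ that appear earlier in the ordering and at most $\max(\Delta,32)+2$ neighbors in $G^2$ that appear earlier in the ordering.
   Context: Graphs are finite and simple. "Contains no $k$-cycle" means $G$ has no cycle of length $k$ as a (not necessarily induced) subgraph. The square $G^2$ of a graph $G$ is the graph on $V(G)$ formed from $G$ by adding an edge between each pair of vertices at distance two in $G$. *)

theory Defs
  imports "HOL-Analysis.Analysis" "Graph_Theory.Graph_Theory"
begin

text \<open>
  Finite simple graphs are values \<open>G :: 'a pair_pre_digraph\<close> satisfying \<^locale>\<open>pair_graph\<close>: an
  undirected edge \<open>uv\<close> is represented by the two arcs \<open>(u, v)\<close> and \<open>(v, u)\<close>. The arc-list cycles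
  of \<^const>\<open>pre_digraph.cycle\<close> of length at least 3 are the ordinary cycles of the graph; only the
  lists \<open>[(u, v), (v, u)]\<close> of length 2 have no undirected counterpart.
\<close>

text \<open>
  In a symmetric digraph the out-degree is the number of neighbours. The added \<open>0\<close> only matters for
  the graph with no vertices.
\<close>

definition max_degree :: "'a pair_pre_digraph \<Rightarrow> nat" where
  "max_degree G = Max (insert 0 (out_degree (with_proj G) ` pverts G))"

text \<open>
  \<^const>\<open>wf_digraph.\<mu>\<close> with unit costs is the length of a shortest walk (\<open>\<infinity>\<close> if there is none).
\<close>

definition graph_dist :: "'a pair_pre_digraph \<Rightarrow> 'a \<Rightarrow> 'a \<Rightarrow> ereal" where
  "graph_dist G u v = wf_digraph.\<mu> (with_proj G) (\<lambda>_. 1) u v"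

definition graph_square :: "'a pair_pre_digraph \<Rightarrow> 'a pair_pre_digraph" where
  "graph_square G =
     \<lparr>pverts = pverts G,
      parcs = parcs G \<union> {(u, v). u \<in> pverts G \<and> v \<in> pverts G \<and> graph_dist G u v = 2}\<rparr>"

text \<open>
  A drawing in the plane without crossings. The curve \<open>\<gamma> {u, v}\<close> is indexed by the unordered pair,
  so the arcs \<open>(u, v)\<close> and \<open>(v, u)\<close> share one curve, whose orientation is immaterial.
  The constant \<open>arc\<close> is that of HOL-Analysis: an injective path on the unit interval.
\<close>

definition plane_drawing ::
  "'a pair_pre_digraph \<Rightarrow> ('a \<Rightarrow> complex) \<Rightarrow> ('a set \<Rightarrow> real \<Rightarrow> complex) \<Rightarrow> bool" where
  "plane_drawing G p \<gamma> \<longleftrightarrow>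
     inj_on p (pverts G) \<and>
     (\<forall>(u, v) \<in> parcs G.
        arc (\<gamma> {u, v}) \<and>
        {pathstart (\<gamma> {u, v}), pathfinish (\<gamma> {u, v})} = {p u, p v} \<and>
        path_image (\<gamma> {u, v}) \<inter> p ` pverts G = {p u, p v}) \<and>
     (\<forall>(u, v) \<in> parcs G. \<forall>(x, y) \<in> parcs G. {u, v} \<noteq> {x, y} \<longrightarrow>
        path_image (\<gamma> {u, v}) \<inter> path_image (\<gamma> {x, y}) \<subseteq> p ` ({u, v} \<inter> {x, y}))"

definition planar :: "'a pair_pre_digraph \<Rightarrow> bool" where
  "planar G \<longleftrightarrow> (\<exists>p \<gamma>. plane_drawing G p \<gamma>)"

definition contains_cycle_of_length :: "'a pair_pre_digraph \<Rightarrow> nat \<Rightarrow> bool" where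
  "contains_cycle_of_length G k \<longleftrightarrow> (\<exists>c. pre_digraph.cycle (with_proj G) c \<and> length c = k)"

definition earlier_neighbors :: "'a pair_pre_digraph \<Rightarrow> 'a list \<Rightarrow> nat \<Rightarrow> 'a set" where
  "earlier_neighbors G vs i = {u \<in> set (take i vs). (u, vs ! i) \<in> parcs G}"

end

theory Submission
  imports Defs
begin

hide_const (open) Digraph_Component.connected

text \<open>
  Put \<open>M = max \<Delta> 32\<close> and peel vertices greedily, each having at most \<open>3\<close> neighbours and \<open>M + 2\<close> neighbours
  in the square among the vertices not yet peeled; peeled vertices go to the end of the order. If the
  peeled set \<open>S\<close> spans an edge, that edge can be deleted: no adjacency in \<open>G\<close> or in the square between
  vertices outside \<open>S\<close> is lost. Likewise a vertex of \<open>S\<close> whose neighbours are pairwise adjacent can be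
  deleted. In a graph where neither is possible, \<open>S\<close> is independent, its vertices have degree \<open>2\<close> or
  \<open>3\<close>, and every vertex outside \<open>S\<close> with at most \<open>3\<close> neighbours outside \<open>S\<close> still has more than \<open>M + 2\<close>
  neighbours in the square there, hence a neighbour of large degree.

  This contradicts planarity by discharging over vertices and triangles alone. With no cycles of length
  \<open>4\<close> or \<open>5\<close> a plane graph with \<open>t\<close> triangles satisfies \<open>4|E| + 6 \<le> 6|V| + 3t\<close>. Instead of going through
  faces and Euler's formula, this is proved by cutting the disc bounded by a cycle along an ear with the
  theta curve theorem; in a nonseparable plane graph some cycle encloses everything.
\<close>

section \<open>Paths and cycles as edge sets\<close>

text \<open>A peeled vertex cannot simply be thrown away: it may be the only link between two
  remaining vertices, which stay adjacent in the square. Hence \<open>S\<close> is still present in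
  the irreducible graph. Its vertices have deficits that their neighbours cover; they can, since an
  edge to \<open>S\<close> brings in more than it costs.

  The density bound is Euler's formula for a nonseparable plane graph with outer cycle
  \<open>D\<close>: the |E| - |V| + 1 inner faces have length 3 or at least 6 and total length 2|E|
  - |D|, so 2|E| - |D| \<ge> 6(|E| - |V| + 1) - 3t. Four times the form without |D| makes the sum of
  8 deg(v) - 24 over all vertices, minus 12t, at most -24.

  The 2 in \<open>M + 2\<close> is for a stuck vertex with two neighbours, both outside
  \<open>S\<close>. It sees M + 3 vertices, at most M of them thanks to one neighbour, so the other
  has degree at least 3, or at least 5 if the two are adjacent. The larger one can afford 7 of the 8
  missing units, or 10 of 12, and the other supplies the rest. The bound 32 excludes that the two
  are merely moderate: one has degree at least 24, or both have degree at least 12.\<close>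

fun path_edges :: "'a list \<Rightarrow> 'a set set" where
  "path_edges (x # y # zs) = insert {x, y} (path_edges (y # zs))"
| "path_edges _ = {}"

definition path_betw :: "'a \<Rightarrow> 'a list \<Rightarrow> 'a \<Rightarrow> bool" where
  "path_betw a xs b \<longleftrightarrow> xs \<noteq> [] \<and> distinct xs \<and> hd xs = a \<and> last xs = b"

text \<open>Cycles are edge sets, without base point or direction, so that a cycle cut at two
  vertices is literally the union of the edge sets of two paths. The length condition rules out a
  single edge closed up.\<close>

definition cyc :: "'a set set \<Rightarrow> bool" where
  "cyc D \<longleftrightarrow> (\<exists>c. distinct c \<and> 3 \<le> length c \<and> D = insert {last c, hd c} (path_edges c))"

lemma finite_path_edges [simp]: "finite (path_edges xs)"
  by (induction xs rule: path_edges.induct) auto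

lemma path_edges_Cons: "xs \<noteq> [] \<Longrightarrow> path_edges (x # xs) = insert {x, hd xs} (path_edges xs)"
  by (cases xs) auto

lemma path_edges_append:
  "xs \<noteq> [] \<Longrightarrow> ys \<noteq> [] \<Longrightarrow>
    path_edges (xs @ ys) = insert {last xs, hd ys} (path_edges xs \<union> path_edges ys)"
  by (induction xs rule: path_edges.induct) (auto simp: path_edges_Cons)

lemma path_edges_rev: "path_edges (rev xs) = path_edges xs"
proof (induction xs)
  case (Cons x xs)
  then show ?case
    by (cases "xs = []") (auto simp: path_edges_append path_edges_Cons last_rev insert_commute)
qed simp

lemma path_edgesD:
  assumes "e \<in> path_edges xs" "distinct xs"
  obtains u v where "e = {u, v}" "u \<noteq> v" "u \<in> set xs" "v \<in> set xs"
  using assms by (induction xs rule: path_edges.induct) auto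

lemma path_edges_subset: "e \<in> path_edges xs \<Longrightarrow> e \<subseteq> set xs"
  by (induction xs rule: path_edges.induct) auto

lemma Union_path_edges: "2 \<le> length xs \<Longrightarrow> \<Union>(path_edges xs) = set xs"
proof (induction xs rule: path_edges.induct)
  case (1 x y zs)
  then show ?case by (cases zs) auto
qed auto

lemma card_path_edges: "distinct xs \<Longrightarrow> card (path_edges xs) = length xs - 1"
proof (induction xs rule: path_edges.induct)
  case (1 x y zs)
  have "{x, y} \<notin> path_edges (y # zs)"
    using path_edges_subset[of "{x, y}" "y # zs"] 1 by auto
  with 1 show ?case by simp
qed auto

lemma path_edges_ends:
  assumes "path_betw a xs b" "{a, b} \<in> path_edges xs"
  shows "xs = [a, b]"
proof -
  obtain ys where xs: "xs = a # ys" "distinct (a # ys)" "last xs = b"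
    using assms by (cases xs) (auto simp: path_betw_def)
  show ?thesis
  proof (cases ys)
    case Nil
    then show ?thesis using assms xs by simp
  next
    case (Cons y zs)
    have "{a, b} \<notin> path_edges (y # zs)"
      using path_edges_subset[of "{a, b}" "y # zs"] xs Cons by auto
    then have "{a, b} = {a, y}" using assms xs Cons by simp
    then have "b = y" using xs Cons by (auto simp: doubleton_eq_iff)
    then have "zs = []" using xs Cons by (cases zs rule: rev_cases) auto
    then show ?thesis using xs Cons \<open>b = y\<close> by simp
  qed
qed

lemma path_betw_length:
  assumes "path_betw a xs b" "a \<noteq> b"
  shows "2 \<le> length xs"
  using assms by (cases xs rule: path_edges.cases) (auto simp: path_betw_def)

lemma path_betw_rev: "path_betw a xs b \<Longrightarrow> path_betw b (rev xs) a"
  by (auto simp: path_betw_def hd_rev last_rev)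

lemma path_betw_in: "path_betw a xs b \<Longrightarrow> a \<in> set xs \<and> b \<in> set xs"
  by (auto simp: path_betw_def)

text \<open>A common edge has both ends in {a, b}, so it is the edge ab, and a simple path
  containing the edge between its own ends is that edge alone.\<close>

lemma disjoint_path_edges:
  assumes "path_betw a xs b" "path_betw a ys b" "set xs \<inter> set ys = {a, b}" "xs \<noteq> [a, b] \<or> ys \<noteq> [a, b]"
  shows "path_edges xs \<inter> path_edges ys = {}"
proof (rule ccontr)
  assume "path_edges xs \<inter> path_edges ys \<noteq> {}"
  then obtain e where e: "e \<in> path_edges xs" "e \<in> path_edges ys" by blast
  obtain u v where uv: "e = {u, v}" "u \<noteq> v" "u \<in> set xs" "v \<in> set xs"
    using path_edgesD[OF e(1)] assms(1) unfolding path_betw_def by metis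
  have "e \<subseteq> {a, b}" using path_edges_subset[OF e(1)] path_edges_subset[OF e(2)] assms(3) by blast
  with uv have "e = {a, b}" by auto
  with e have "xs = [a, b]" "ys = [a, b]"
    using path_edges_ends[OF assms(1)] path_edges_ends[OF assms(2)] by simp_all
  then show False using assms(4) by simp
qed

lemma card_path_betw: "path_betw a xs b \<Longrightarrow> card (set xs) = card (path_edges xs) + 1"
  by (cases xs) (auto simp: path_betw_def card_path_edges distinct_card)

lemma cycle_edges_rotate:
  "xs \<noteq> [] \<Longrightarrow> ys \<noteq> [] \<Longrightarrow> insert {last (xs @ ys), hd (xs @ ys)} (path_edges (xs @ ys))
     = insert {last (ys @ xs), hd (ys @ xs)} (path_edges (ys @ xs))"
  by (auto simp: path_edges_append)

lemma cyc_Union: "distinct c \<Longrightarrow> 3 \<le> length c \<Longrightarrow> \<Union>(insert {last c, hd c} (path_edges c)) = set c"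
  using Union_path_edges[of c] by (cases "c = []") auto

text \<open>Rotate the vertex list so that \<open>a\<close> comes first and cut it at
  \<open>b\<close>; the second path leaves \<open>a\<close> by the closing edge and reads the tail
  backwards.\<close>

lemma cyc_split:
  assumes "cyc D" "a \<in> \<Union>D" "b \<in> \<Union>D" "a \<noteq> b"
  obtains xs ys where "path_betw a xs b" "path_betw a ys b" "set xs \<inter> set ys = {a, b}"
    "D = path_edges xs \<union> path_edges ys" "path_edges xs \<inter> path_edges ys = {}"
proof -
  obtain c where c: "distinct c" "3 \<le> length c" "D = insert {last c, hd c} (path_edges c)"
    using assms(1) by (auto simp: cyc_def)
  have ab: "a \<in> set c" "b \<in> set c" using assms cyc_Union[OF c(1,2)] c(3) by auto
  obtain us vs where "c = us @ a # vs" using ab by (metis split_list)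
  then obtain ws where ws: "distinct (a # ws)" "3 \<le> length (a # ws)" "set (a # ws) = set c"
     "D = insert {last (a # ws), a} (path_edges (a # ws))"
  proof (cases "us = []")
    case True
    then show ?thesis using that[of vs] c \<open>c = us @ a # vs\<close> by auto
  next
    case False
    have "D = insert {last (a # vs @ us), a} (path_edges (a # vs @ us))"
      using cycle_edges_rotate[OF False, of "a # vs"] c(3) \<open>c = us @ a # vs\<close> by simp
    then show ?thesis using that[of "vs @ us"] c \<open>c = us @ a # vs\<close> by auto
  qed
  have "b \<in> set ws" using ab ws assms(4) by auto
  then obtain ps qs where ps: "ws = ps @ b # qs" by (metis split_list)
  define xs where "xs = a # ps @ [b]"
  define ys where "ys = a # rev qs @ [b]"
  have 1: "path_betw a xs b" "path_betw a ys b"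
    using ws ps by (auto simp: path_betw_def xs_def ys_def)
  have 2: "set xs \<inter> set ys = {a, b}" using ws ps by (auto simp: xs_def ys_def)
  have e1: "path_edges (a # ws) = path_edges xs \<union> path_edges (b # qs)"
    using path_edges_append[of "a # ps" "b # qs"] path_edges_append[of "a # ps" "[b]"]
    by (auto simp: xs_def ps)
  have "path_edges ys = path_edges (b # qs @ [a])"
    using path_edges_rev[of ys] by (simp add: ys_def)
  also have "\<dots> = insert {last (a # ws), a} (path_edges (b # qs))"
    using path_edges_append[of "b # qs" "[a]"] by (simp add: ps)
  finally have 3: "D = path_edges xs \<union> path_edges ys" using e1 ws(4) by auto
  \<comment> \<open>A cycle has at least three vertices, so one of the two paths has an inner
    vertex.\<close>
  have "xs \<noteq> [a, b] \<or> ys \<noteq> [a, b]" using ws(2) ps by (auto simp: xs_def ys_def)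
  then show ?thesis using that[OF 1 2 3] disjoint_path_edges[OF 1 2] by blast
qed

lemma cyc_join:
  assumes "path_betw a xs b" "path_betw a ys b" "a \<noteq> b" "set xs \<inter> set ys = {a, b}"
    "xs \<noteq> [a, b] \<or> ys \<noteq> [a, b]"
  shows "cyc (path_edges xs \<union> path_edges ys)"
proof -
  have "2 \<le> length ys" "2 \<le> length xs"
    using path_betw_length[OF assms(1,3)] path_betw_length[OF assms(2,3)] by simp_all
  obtain ys' where ys: "ys = a # ys'" using assms by (cases ys) (auto simp: path_betw_def)
  with \<open>2 \<le> length ys\<close> obtain ms where ms: "ys = a # ms @ [b]"
    using assms by (cases ys' rule: rev_cases) (auto simp: path_betw_def)
  obtain xs' where xs: "xs = xs' @ [b]" "xs' \<noteq> []" "hd xs' = a"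
  proof
    show "xs = butlast xs @ [b]" using assms(1) by (auto simp: path_betw_def)
    show "butlast xs \<noteq> []" using \<open>2 \<le> length xs\<close> by (cases xs rule: path_edges.cases) auto
    then show "hd (butlast xs) = a" using assms(1) by (cases xs) (auto simp: path_betw_def)
  qed
  let ?c = "xs @ rev ms"
  have "set xs \<inter> set ms \<subseteq> {a, b}" using assms(4) ms by auto
  then have "set xs \<inter> set ms = {}" using assms(2) ms by (auto simp: path_betw_def)
  then have "distinct ?c" using assms(1,2) ms by (auto simp: path_betw_def)
  moreover have "3 \<le> length ?c"
  proof (cases "ms = []")
    case True
    then have "xs \<noteq> [a,b]" using assms(5) ms by auto
    then have "length xs \<noteq> 2" using xs by (cases xs') auto
    then show ?thesis using \<open>2 \<le> length xs\<close> by simp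
  next
    case False
    then have "1 \<le> length ms" by (cases ms) auto
    then show ?thesis using \<open>2 \<le> length xs\<close> by simp
  qed
  moreover have "path_edges ys = insert {last ?c, hd ?c} (path_edges (b # rev ms))"
  proof -
    have "path_edges ys = path_edges (b # rev ms @ [a])" 
      using path_edges_rev[of ys] by (simp add: ms)
    then show ?thesis using path_edges_append[of "b # rev ms" "[a]"] xs by auto
  qed
  then have "path_edges xs \<union> path_edges ys = insert {last ?c, hd ?c} (path_edges ?c)"
    using path_edges_append[of xs' "b # rev ms"] path_edges_append[of xs' "[b]"] xs by auto
  ultimately show ?thesis unfolding cyc_def by blast
qed

lemma cyc_card_Union: "cyc D \<Longrightarrow> card (\<Union>D) = card D \<and> 3 \<le> card D \<and> finite D"
proof -
  assume "cyc D"
  then obtain c where c: "distinct c" "3 \<le> length c" "D = insert {last c, hd c} (path_edges c)"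
    by (auto simp: cyc_def)
  have "{last c, hd c} \<notin> path_edges c"
  proof
    assume "{last c, hd c} \<in> path_edges c"
    then have "c = [hd c, last c]"
      using c path_edges_ends[of "hd c" c "last c"]
      by (cases "c = []") (auto simp: path_betw_def insert_commute)
    then show False using c(2) by (metis length_Cons list.size(3) numeral_3_eq_3 less_eq_Suc_le lessI not_less_iff_gr_or_eq nat_neq_iff)
  qed
  then have "card D = length c" using c by (simp add: card_path_edges)
  then show ?thesis using cyc_Union[OF c(1,2)] c by (simp add: distinct_card)
qed

lemma cyc_edgeD:
  assumes "cyc D" "e \<in> D"
  obtains u v where "e = {u, v}" "u \<noteq> v"
proof -
  obtain c where c: "distinct c" "3 \<le> length c" "D = insert {last c, hd c} (path_edges c)"
    using assms by (auto simp: cyc_def)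
  have "last c \<noteq> hd c" using c by (cases c rule: path_edges.cases) auto
  then show ?thesis using c assms(2) that by (auto elim: path_edgesD)
qed

text \<open>The two paths between the ends of \<open>e\<close> both leave \<open>v\<close>, and by
  disjointness only one of them can use \<open>e\<close>.\<close>

lemma cyc_other_edge:
  assumes "cyc D" "e \<in> D" "v \<in> e"
  obtains f where "f \<in> D" "f \<noteq> e" "v \<in> f"
proof -
  obtain u where u: "e = {u, v}" "u \<noteq> v" using cyc_edgeD[OF assms(1,2)] assms(3) by (metis doubleton_eq_iff empty_iff insert_iff)
  obtain xs ys where x: "path_betw v xs u" "path_betw v ys u" "D = path_edges xs \<union> path_edges ys"
      "path_edges xs \<inter> path_edges ys = {}"
    using cyc_split[OF assms(1), of v u] u assms(2) by blast
  have ex: "\<exists>f\<in>path_edges zs. v \<in> f" if "path_betw v zs u" for zs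
    using Union_path_edges[OF path_betw_length[OF that]] path_betw_in[OF that] u(2) by auto
  show ?thesis using ex[OF x(1)] ex[OF x(2)] x(3,4) that by (metis IntI UnCI empty_iff)
qed

text \<open>The first vertex of a path meets only the first edge, whereas a cycle has two edges at
  each vertex; so the cycle would lie in the rest of the path. This is why no triangle is counted on
  both sides of a cut along a path.\<close>

lemma no_cyc_path:
  assumes "distinct xs" "D \<subseteq> path_edges xs" shows "\<not> cyc D"
  using assms
proof (induction xs rule: path_edges.induct)
  case (1 x y zs)
  show ?case
  proof
    assume c: "cyc D"
    then have "{x, y} \<in> D" using 1 by auto
    then obtain f where "f \<in> D" "f \<noteq> {x, y}" "x \<in> f" using cyc_other_edge[OF c] by blast
    then show False using 1 path_edges_subset[of f "y # zs"] by auto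
  qed
qed (use cyc_card_Union in fastforce)+

section \<open>Plane drawings and discs\<close>

text \<open>Edges are sets and the drawing is a parameter, so a subgraph inherits \<open>p\<close>
  and \<open>\<gamma>\<close> unchanged and all inductions run inside one fixed drawing.\<close>

definition plane :: "'a set \<Rightarrow> 'a set set \<Rightarrow> ('a \<Rightarrow> complex) \<Rightarrow> ('a set \<Rightarrow> real \<Rightarrow> complex) \<Rightarrow> bool" where
  "plane V E p \<gamma> \<longleftrightarrow> finite V \<and> inj_on p V \<and>
     (\<forall>e\<in>E. e \<subseteq> V \<and> card e = 2 \<and> arc (\<gamma> e) \<and>
        {pathstart (\<gamma> e), pathfinish (\<gamma> e)} = p ` e \<and> path_image (\<gamma> e) \<inter> p ` V = p ` e) \<and>
     (\<forall>e\<in>E. \<forall>f\<in>E. e \<noteq> f \<longrightarrow> path_image (\<gamma> e) \<inter> path_image (\<gamma> f) \<subseteq> p ` (e \<inter> f))"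

definition curve :: "('a set \<Rightarrow> real \<Rightarrow> complex) \<Rightarrow> 'a set set \<Rightarrow> complex set" where
  "curve \<gamma> F = (\<Union>e\<in>F. path_image (\<gamma> e))"

definition disc :: "('a set \<Rightarrow> real \<Rightarrow> complex) \<Rightarrow> 'a set set \<Rightarrow> complex set" where
  "disc \<gamma> D = curve \<gamma> D \<union> inside (curve \<gamma> D)"

lemma plane_image_vertices: "plane V E p \<gamma> \<Longrightarrow> e \<in> E \<Longrightarrow> path_image (\<gamma> e) \<inter> p ` V = p ` e"
  unfolding plane_def by blast

lemma plane_image_Int:
  "plane V E p \<gamma> \<Longrightarrow> e \<in> E \<Longrightarrow> f \<in> E \<Longrightarrow> e \<noteq> f \<Longrightarrow>
    path_image (\<gamma> e) \<inter> path_image (\<gamma> f) \<subseteq> p ` (e \<inter> f)"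
  unfolding plane_def by blast

lemma plane_subgraph:
  assumes "plane V E p \<gamma>" "V' \<subseteq> V" "E' \<subseteq> E" "\<And>e. e \<in> E' \<Longrightarrow> e \<subseteq> V'"
  shows "plane V' E' p \<gamma>"
proof -
  have img: "path_image (\<gamma> e) \<inter> p ` V' = p ` e" if "e \<in> E'" for e
  proof -
    have 1: "path_image (\<gamma> e) \<inter> p ` V = p ` e"
      using plane_image_vertices[OF assms(1)] assms(3) that by blast
    have 2: "p ` V' \<subseteq> p ` V" "p ` e \<subseteq> p ` V'" using assms(2) assms(4)[OF that] by auto
    have "X \<inter> A = C \<Longrightarrow> B \<subseteq> A \<Longrightarrow> C \<subseteq> B \<Longrightarrow> X \<inter> B = C" for X A B C :: "complex set"
      by blast
    from this[OF 1 2] show ?thesis .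
  qed
  have fin: "finite V'" "inj_on p V'"
    using assms(1,2) by (auto simp: plane_def intro: finite_subset inj_on_subset)
  have arcs: "card e = 2" "arc (\<gamma> e)" "{pathstart (\<gamma> e), pathfinish (\<gamma> e)} = p ` e" if "e \<in> E'" for e
    using assms(1,3) that by (auto simp: plane_def)
  have int: "path_image (\<gamma> e) \<inter> path_image (\<gamma> f) \<subseteq> p ` (e \<inter> f)" if "e \<in> E'" "f \<in> E'" "e \<noteq> f" for e f
    using plane_image_Int[OF assms(1)] assms(3) that by blast
  show ?thesis
    unfolding plane_def
    by (intro conjI ballI impI; rule fin assms(4) arcs img int; assumption)
qed

lemma plane_finite: "plane V E p \<gamma> \<Longrightarrow> finite V \<and> finite E"
proof -
  assume "plane V E p \<gamma>"
  then have "finite V" "E \<subseteq> Pow V" by (auto simp: plane_def)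
  then show ?thesis using finite_subset[of E "Pow V"] by auto
qed

lemma plane_edge:
  assumes "plane V E p \<gamma>" "e \<in> E"
  obtains u v where "e = {u, v}" "u \<noteq> v" "u \<in> V" "v \<in> V" "arc (\<gamma> e)"
    "pathstart (\<gamma> e) = p u" "pathfinish (\<gamma> e) = p v"
proof -
  have e: "e \<subseteq> V" "card e = 2" "arc (\<gamma> e)" "{pathstart (\<gamma> e), pathfinish (\<gamma> e)} = p ` e"
    using assms by (auto simp: plane_def)
  obtain u v where uv: "e = {u, v}" "u \<noteq> v" using e(2) by (auto simp: card_2_iff)
  have "{pathstart (\<gamma> e), pathfinish (\<gamma> e)} = {p u, p v}" using e(4) uv by simp
  then consider "pathstart (\<gamma> e) = p u" "pathfinish (\<gamma> e) = p v"
    | "pathstart (\<gamma> e) = p v" "pathfinish (\<gamma> e) = p u"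
    by (auto simp: doubleton_eq_iff)
  then show ?thesis
  proof cases
    case 1
    show ?thesis by (rule that[of u v]) (use 1 uv e in auto)
  next
    case 2
    show ?thesis by (rule that[of v u]) (use 2 uv e in auto)
  qed
qed

lemma curve_Un: "curve \<gamma> (A \<union> B) = curve \<gamma> A \<union> curve \<gamma> B"
  by (auto simp: curve_def)

lemma compact_curve:
  assumes "plane V E p \<gamma>" "F \<subseteq> E"
  shows "compact (curve \<gamma> F)"
proof -
  have "finite F" using plane_finite[OF assms(1)] assms(2) finite_subset by blast
  moreover have "compact (path_image (\<gamma> e))" if "e \<in> F" for e
    using assms that by (auto simp: plane_def intro: compact_path_image arc_imp_path)
  ultimately show ?thesis unfolding curve_def by blast
qed

lemma vertex_on_curve:
  assumes "plane V E p \<gamma>" "F \<subseteq> E" "v \<in> V"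
  shows "p v \<in> curve \<gamma> F \<longleftrightarrow> v \<in> \<Union>F"
proof -
  have "p v \<in> path_image (\<gamma> e) \<longleftrightarrow> v \<in> e" if "e \<in> F" for e
  proof -
    have e: "e \<in> E" using that assms by auto
    have "e \<subseteq> V" "inj_on p V" using assms(1) e by (auto simp: plane_def)
    then have "p v \<in> p ` e \<longleftrightarrow> v \<in> e" using assms(3) by (simp add: inj_on_image_mem_iff)
    then show ?thesis using plane_image_vertices[OF assms(1) e] assms(3) by blast
  qed
  then show ?thesis by (auto simp: curve_def)
qed

lemma curve_Int:
  assumes "plane V E p \<gamma>" "F \<subseteq> E" "F' \<subseteq> E" "F \<inter> F' = {}"
  shows "curve \<gamma> F \<inter> curve \<gamma> F' \<subseteq> p ` (\<Union>F \<inter> \<Union>F')"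
proof
  fix z assume "z \<in> curve \<gamma> F \<inter> curve \<gamma> F'"
  then obtain e f where ef: "e \<in> F" "f \<in> F'" "z \<in> path_image (\<gamma> e)" "z \<in> path_image (\<gamma> f)"
    by (auto simp: curve_def)
  moreover have "e \<noteq> f" "e \<in> E" "f \<in> E" using ef assms by auto
  ultimately show "z \<in> p ` (\<Union>F \<inter> \<Union>F')" using plane_image_Int[OF assms(1), of e f] by blast
qed

section \<open>Edges without their end points\<close>

definition open_edge :: "('a \<Rightarrow> complex) \<Rightarrow> ('a set \<Rightarrow> real \<Rightarrow> complex) \<Rightarrow> 'a set \<Rightarrow> complex set" where
  "open_edge p \<gamma> e = path_image (\<gamma> e) - p ` e"

lemma open_edge:
  assumes "plane V E p \<gamma>" "e \<in> E"
  shows "connected (open_edge p \<gamma> e)" "open_edge p \<gamma> e \<noteq> {}"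
    "path_image (\<gamma> e) \<subseteq> closure (open_edge p \<gamma> e)"
proof -
  have sp: "simple_path (\<gamma> e)" and "p ` e = {pathstart (\<gamma> e), pathfinish (\<gamma> e)}"
    using assms by (auto simp: plane_def arc_imp_simple_path)
  then have eq: "open_edge p \<gamma> e = path_image (\<gamma> e) - {pathstart (\<gamma> e), pathfinish (\<gamma> e)}"
    by (simp add: open_edge_def)
  show "connected (open_edge p \<gamma> e)" unfolding eq by (rule connected_simple_path_endless[OF sp])
  show "open_edge p \<gamma> e \<noteq> {}" unfolding eq by (rule nonempty_simple_path_endless[OF sp])
  have eq': "open_edge p \<gamma> e = \<gamma> e ` {0<..<1}" unfolding eq by (rule simple_path_endless[OF sp])
  have "continuous_on {0..1} (\<gamma> e)" using sp by (simp add: simple_path_def path_def)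
  then have "\<gamma> e ` closure {0<..<1} \<subseteq> closure (\<gamma> e ` {0<..<1})"
    by (intro image_closure_subset) (auto simp: closure_subset)
  then show "path_image (\<gamma> e) \<subseteq> closure (open_edge p \<gamma> e)"
    by (simp add: eq' path_image_def)
qed

lemma open_edge_Int_curve:
  assumes "plane V E p \<gamma>" "e \<in> E" "F \<subseteq> E" "e \<notin> F"
  shows "open_edge p \<gamma> e \<inter> curve \<gamma> F = {}"
proof -
  have "path_image (\<gamma> e) \<inter> path_image (\<gamma> f) \<subseteq> p ` e" if "f \<in> F" for f
    using plane_image_Int[OF assms(1,2), of f] that assms(3,4) by fastforce
  then show ?thesis by (auto simp: open_edge_def curve_def)
qed

lemma edge_in_curve:
  assumes "plane V E p \<gamma>" "e \<in> E" "F \<subseteq> E" "path_image (\<gamma> e) \<subseteq> curve \<gamma> F"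
  shows "e \<in> F"
proof (rule ccontr)
  assume "e \<notin> F"
  then have "open_edge p \<gamma> e \<inter> curve \<gamma> F = {}" by (rule open_edge_Int_curve[OF assms(1-3)])
  moreover have "open_edge p \<gamma> e \<subseteq> path_image (\<gamma> e)" by (auto simp: open_edge_def)
  ultimately show False using open_edge(2)[OF assms(1,2)] assms(4) by blast
qed

lemma connected_subset_inside:
  assumes "connected U" "U \<inter> S = {}" "U \<inter> inside S \<noteq> {}"
  shows "U \<subseteq> inside S"
proof
  fix y assume "y \<in> U"
  obtain x where "x \<in> U" "x \<in> inside S" using assms(3) by blast
  have "connected_component (- S) x y"
    unfolding connected_component_def using assms(1,2) \<open>x \<in> U\<close> \<open>y \<in> U\<close> by blast
  then show "y \<in> inside S" using inside_same_component \<open>x \<in> inside S\<close> by blast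
qed

text \<open>The open edge is connected and avoids the boundary curve, so a single point in the disc
  puts all of it inside; the end points follow by closure.\<close>

lemma edge_in_disc:
  assumes "plane V E p \<gamma>" "e \<in> E" "D \<subseteq> E" "e \<notin> D" "open_edge p \<gamma> e \<inter> disc \<gamma> D \<noteq> {}"
  shows "path_image (\<gamma> e) \<subseteq> disc \<gamma> D" "open_edge p \<gamma> e \<subseteq> inside (curve \<gamma> D)"
proof -
  have "open_edge p \<gamma> e \<inter> curve \<gamma> D = {}" using assms open_edge_Int_curve by metis
  moreover from this have "open_edge p \<gamma> e \<inter> inside (curve \<gamma> D) \<noteq> {}"
    using assms(5) by (auto simp: disc_def)
  ultimately show *: "open_edge p \<gamma> e \<subseteq> inside (curve \<gamma> D)"
    using connected_subset_inside open_edge(1)[OF assms(1,2)] by metis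
  have "closed (curve \<gamma> D)" using compact_curve[OF assms(1,3)] compact_imp_closed by blast
  then have "closure (inside (curve \<gamma> D)) \<subseteq> disc \<gamma> D"
    using closure_inside_subset unfolding disc_def by blast
  then show "path_image (\<gamma> e) \<subseteq> disc \<gamma> D"
    using open_edge(3)[OF assms(1,2)] closure_mono[OF *] by blast
qed

text \<open>The orientation of \<open>\<gamma> e\<close> is arbitrary, so arcs are reversed where
  necessary before joining. The join stays injective because the first edge meets the rest of the
  path only in its second vertex.\<close>

lemma path_curve_arc:
  assumes "plane V E p \<gamma>" "path_betw a xs b" "a \<noteq> b" "path_edges xs \<subseteq> E"
  obtains g where "arc g" "pathstart g = p a" "pathfinish g = p b"
    "path_image g = curve \<gamma> (path_edges xs)"
proof -
  have edge: "\<exists>g. arc g \<and> pathstart g = p x \<and> pathfinish g = p y \<and> path_image g = path_image (\<gamma> {x, y})"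
    if "{x, y} \<in> E" "x \<noteq> y" for x y
  proof -
    obtain u v where *: "{x, y} = {u, v}" "arc (\<gamma> {x, y})"
      "pathstart (\<gamma> {x, y}) = p u" "pathfinish (\<gamma> {x, y}) = p v"
      using plane_edge[OF assms(1) \<open>{x, y} \<in> E\<close>] by metis
    show ?thesis
    proof (cases "x = u")
      case True
      then have "v = y" using * by (auto simp: doubleton_eq_iff)
      then show ?thesis using * True by (intro exI[of _ "\<gamma> {x, y}"]) auto
    next
      case False
      then have "x = v" "y = u" using * by (auto simp: doubleton_eq_iff)
      then show ?thesis using * by (intro exI[of _ "reversepath (\<gamma> {x, y})"]) (auto simp: arc_reversepath)
    qed
  qed
  have "\<exists>g. arc g \<and> pathstart g = p (hd xs) \<and> pathfinish g = p (last xs) \<and>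
      path_image g = curve \<gamma> (path_edges xs)"
    if "2 \<le> length xs" "distinct xs" "path_edges xs \<subseteq> E" for xs
    using that
  proof (induction xs rule: path_edges.induct)
    case (1 x y zs)
    then have xy: "{x, y} \<in> E" "x \<noteq> y" by auto
    obtain g1 where g1: "arc g1" "pathstart g1 = p x" "pathfinish g1 = p y" "path_image g1 = path_image (\<gamma> {x, y})"
      using edge[OF xy] by blast
    show ?case
    proof (cases "zs = []")
      case True
      then show ?thesis using g1 by (auto simp: curve_def)
    next
      case False
      then have "2 \<le> length (y # zs)" by (cases zs) auto
      then obtain g2 where g2: "arc g2" "pathstart g2 = p y" "pathfinish g2 = p (last zs)"
        "path_image g2 = curve \<gamma> (path_edges (y # zs))"
        using 1 False by auto
      have "{x, y} \<notin> path_edges (y # zs)" using path_edges_subset[of "{x, y}" "y # zs"] 1 by auto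
      then have "curve \<gamma> {{x, y}} \<inter> curve \<gamma> (path_edges (y # zs)) \<subseteq> p ` (\<Union>{{x, y}} \<inter> \<Union>(path_edges (y # zs)))"
        using 1 by (intro curve_Int[OF assms(1)]) auto
      also have "\<dots> \<subseteq> {p y}" using path_edges_subset[of _ "y # zs"] 1 by fastforce
      finally have "path_image g1 \<inter> path_image g2 \<subseteq> {pathstart g2}"
        by (simp add: g1 g2 curve_def)
      then have "arc (g1 +++ g2)" using g1 g2 by (intro arc_join) auto
      moreover have "path_image (g1 +++ g2) = curve \<gamma> (path_edges (x # y # zs))"
        using g1 g2 by (simp add: path_image_join curve_def)
      ultimately show ?thesis using g1 g2 False by (intro exI[of _ "g1 +++ g2"]) auto
    qed
  qed auto
  then show ?thesis
    using that path_betw_length[OF assms(2,3)] assms(2,4) unfolding path_betw_def by metis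
qed

text \<open>Disjointness of the edge sets is required separately: the conditions on vertices alone
  would allow two of the paths to be the same single edge.\<close>

locale theta =
  fixes V :: "'a set" and E p \<gamma> a b xs ys zs
  assumes plane: "plane V E p \<gamma>" and ab: "a \<noteq> b"
    and paths: "path_betw a xs b" "path_betw a ys b" "path_betw a zs b"
    and edges: "path_edges xs \<subseteq> E" "path_edges ys \<subseteq> E" "path_edges zs \<subseteq> E"
    and Int: "set xs \<inter> set ys = {a, b}" "set xs \<inter> set zs = {a, b}" "set ys \<inter> set zs = {a, b}"
    and disj: "path_edges xs \<inter> path_edges ys = {}" "path_edges xs \<inter> path_edges zs = {}"
      "path_edges ys \<inter> path_edges zs = {}"
begin

abbreviation "X \<equiv> path_edges xs"
abbreviation "Y \<equiv> path_edges ys"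
abbreviation "Z \<equiv> path_edges zs"

lemma ab_on:
  assumes "path_betw a us b" "path_edges us \<subseteq> E"
  shows "{p a, p b} \<subseteq> curve \<gamma> (path_edges us)"
proof -
  obtain g where "arc g" "pathstart g = p a" "pathfinish g = p b" "path_image g = curve \<gamma> (path_edges us)"
    using path_curve_arc[OF plane assms(1) ab assms(2)] by metis
  then show ?thesis using pathstart_in_path_image[of g] pathfinish_in_path_image[of g] by simp
qed

lemma curve_paths_Int:
  assumes "path_betw a us b" "path_edges us \<subseteq> E" "path_betw a vs b" "path_edges vs \<subseteq> E"
    "path_edges us \<inter> path_edges vs = {}" "set us \<inter> set vs = {a, b}"
  shows "curve \<gamma> (path_edges us) \<inter> curve \<gamma> (path_edges vs) = {p a, p b}"
proof
  have "\<Union>(path_edges us) \<inter> \<Union>(path_edges vs) \<subseteq> {a, b}"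
    using Union_path_edges[OF path_betw_length[OF assms(1) ab]]
      Union_path_edges[OF path_betw_length[OF assms(3) ab]] assms(6) by simp
  then show "curve \<gamma> (path_edges us) \<inter> curve \<gamma> (path_edges vs) \<subseteq> {p a, p b}"
    using curve_Int[OF plane assms(2,4,5)] image_mono[of _ "{a, b}" p] by (simp add: subset_trans)
  show "{p a, p b} \<subseteq> curve \<gamma> (path_edges us) \<inter> curve \<gamma> (path_edges vs)"
    using ab_on[OF assms(1,2)] ab_on[OF assms(3,4)] by blast
qed

lemma curves_Int:
  "curve \<gamma> X \<inter> curve \<gamma> Y = {p a, p b}"
  "curve \<gamma> X \<inter> curve \<gamma> Z = {p a, p b}"
  "curve \<gamma> Y \<inter> curve \<gamma> Z = {p a, p b}"
  using paths edges Int disj by (intro curve_paths_Int; simp)+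

lemma p_ab: "p a \<noteq> p b"
proof -
  have "a \<in> V" "b \<in> V"
  proof -
    have "\<Union>E \<subseteq> V" using plane by (auto simp: plane_def)
    then have "set xs \<subseteq> V"
      using Union_path_edges[OF path_betw_length[OF paths(1) ab]] Union_mono[OF edges(1)] by simp
    then show "a \<in> V" "b \<in> V" using path_betw_in[OF paths(1)] by auto
  qed
  then show ?thesis using ab plane unfolding plane_def by (meson inj_onD)
qed

lemma inside_split:
  assumes "curve \<gamma> Z \<inter> inside (curve \<gamma> (X \<union> Y)) \<noteq> {}"
  shows "inside (curve \<gamma> (X \<union> Z)) \<inter> inside (curve \<gamma> (Y \<union> Z)) = {}"
    "inside (curve \<gamma> (X \<union> Z)) \<union> inside (curve \<gamma> (Y \<union> Z)) \<union> (curve \<gamma> Z - {p a, p b})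
      = inside (curve \<gamma> (X \<union> Y))"
proof -
  obtain g1 where g1: "arc g1" "pathstart g1 = p a" "pathfinish g1 = p b" "path_image g1 = curve \<gamma> X"
    using path_curve_arc[OF plane paths(1) ab edges(1)] by metis
  obtain g2 where g2: "arc g2" "pathstart g2 = p a" "pathfinish g2 = p b" "path_image g2 = curve \<gamma> Y"
    using path_curve_arc[OF plane paths(2) ab edges(2)] by metis
  obtain g3 where g3: "arc g3" "pathstart g3 = p a" "pathfinish g3 = p b" "path_image g3 = curve \<gamma> Z"
    using path_curve_arc[OF plane paths(3) ab edges(3)] by metis
  have "inside (path_image g1 \<union> path_image g3) \<inter> inside (path_image g2 \<union> path_image g3) = {} \<and>
      inside (path_image g1 \<union> path_image g3) \<union> inside (path_image g2 \<union> path_image g3) \<union>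
        (path_image g3 - {p a, p b}) = inside (path_image g1 \<union> path_image g2)"
    by (rule split_inside_simple_closed_curve[of g1 "p a" "p b" g2 g3])
      (use g1 g2 g3 p_ab assms in \<open>simp_all add: arc_imp_simple_path curves_Int curve_Un\<close>)
  then show "inside (curve \<gamma> (X \<union> Z)) \<inter> inside (curve \<gamma> (Y \<union> Z)) = {}"
    "inside (curve \<gamma> (X \<union> Z)) \<union> inside (curve \<gamma> (Y \<union> Z)) \<union> (curve \<gamma> Z - {p a, p b})
      = inside (curve \<gamma> (X \<union> Y))"
    by (simp_all add: g1 g2 g3 curve_Un)
qed

text \<open>The open halves are disjoint and avoid the outer curve, and each outer path meets the
  cut only at its ends; so nothing but \<open>Z\<close> is shared.\<close>

lemma disc_split:
  assumes "curve \<gamma> Z \<inter> inside (curve \<gamma> (X \<union> Y)) \<noteq> {}"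
  shows "disc \<gamma> (X \<union> Z) \<union> disc \<gamma> (Y \<union> Z) = disc \<gamma> (X \<union> Y)"
    "disc \<gamma> (X \<union> Z) \<inter> disc \<gamma> (Y \<union> Z) = curve \<gamma> Z"
proof -
  note s = inside_split[OF assms]
  have n: "inside S \<inter> S = {}" for S :: "complex set" using inside_no_overlap by blast
  have "{p a, p b} \<subseteq> curve \<gamma> X" using ab_on paths edges by blast
  then show "disc \<gamma> (X \<union> Z) \<union> disc \<gamma> (Y \<union> Z) = disc \<gamma> (X \<union> Y)"
    using s unfolding disc_def curve_Un by blast
  show "disc \<gamma> (X \<union> Z) \<inter> disc \<gamma> (Y \<union> Z) = curve \<gamma> Z"
    using s curves_Int n[of "curve \<gamma> (X \<union> Y)"] n[of "curve \<gamma> (X \<union> Z)"] n[of "curve \<gamma> (Y \<union> Z)"]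
    unfolding disc_def curve_Un by blast
qed

lemma theta_swap: "theta V E p \<gamma> a b xs zs ys" "theta V E p \<gamma> a b ys zs xs"
  using plane ab paths edges Int disj by unfold_locales blast+

lemma Jordan:
  "inside (curve \<gamma> (X \<union> Y)) \<noteq> {}" "connected (inside (curve \<gamma> (X \<union> Y)))"
  "bounded (inside (curve \<gamma> (X \<union> Y)))" "connected (outside (curve \<gamma> (X \<union> Y)))"
  "frontier (inside (curve \<gamma> (X \<union> Y))) = curve \<gamma> (X \<union> Y)"
proof -
  obtain g1 where g1: "arc g1" "pathstart g1 = p a" "pathfinish g1 = p b" "path_image g1 = curve \<gamma> X"
    using path_curve_arc[OF plane paths(1) ab edges(1)] by metis
  obtain g2 where g2: "arc g2" "pathstart g2 = p a" "pathfinish g2 = p b" "path_image g2 = curve \<gamma> Y"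
    using path_curve_arc[OF plane paths(2) ab edges(2)] by metis
  let ?g = "g1 +++ reversepath g2"
  have "simple_path ?g" "pathfinish ?g = pathstart ?g"
    using g1 g2 curves_Int by (auto simp: simple_path_join_loop_eq arc_reversepath)
  from Jordan_inside_outside[OF this] show
    "inside (curve \<gamma> (X \<union> Y)) \<noteq> {}" "connected (inside (curve \<gamma> (X \<union> Y)))"
    "bounded (inside (curve \<gamma> (X \<union> Y)))" "connected (outside (curve \<gamma> (X \<union> Y)))"
    "frontier (inside (curve \<gamma> (X \<union> Y))) = curve \<gamma> (X \<union> Y)"
    using g1 g2 by (auto simp: path_image_join curve_Un)
qed

lemma bounded_disc: "bounded (disc \<gamma> (X \<union> Y))"
  using Jordan(3) compact_curve[OF plane, of "X \<union> Y"] edges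
  unfolding disc_def by (simp add: compact_imp_bounded)

text \<open>Janiszewski's theorem: a point outside both cycles through \<open>Z\<close> is outside the third cycle.\<close>

lemma disc_grows:
  assumes "curve \<gamma> Z \<inter> inside (curve \<gamma> (X \<union> Y)) = {}"
  shows "disc \<gamma> (X \<union> Y) \<subseteq> disc \<gamma> (X \<union> Z) \<or> disc \<gamma> (X \<union> Y) \<subseteq> disc \<gamma> (Y \<union> Z)"
proof -
  interpret XZ: theta V E p \<gamma> a b xs zs ys by (rule theta_swap)
  interpret YZ: theta V E p \<gamma> a b ys zs xs by (rule theta_swap)
  let ?I = "inside (curve \<gamma> (X \<union> Y))"
  obtain x where x: "x \<in> ?I" using Jordan(1) by blast
  have noXY: "?I \<inter> curve \<gamma> (X \<union> Y) = {}" using inside_no_overlap by blast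
  have "\<not> bounded (UNIV :: complex set)" by (rule not_bounded_UNIV)
  moreover have "bounded (disc \<gamma> (X \<union> Y) \<union> disc \<gamma> (X \<union> Z) \<union> disc \<gamma> (Y \<union> Z))"
    using bounded_disc XZ.bounded_disc YZ.bounded_disc by simp
  \<comment> \<open>A point far away, outside all three discs, plays the role of infinity.\<close>
  ultimately obtain y where y: "y \<notin> disc \<gamma> (X \<union> Y)" "y \<notin> disc \<gamma> (X \<union> Z)" "y \<notin> disc \<gamma> (Y \<union> Z)"
    by (metis UnI1 UnI2 UNIV_eq_I)
  have out: "S \<union> inside S = - outside S" for S :: "complex set" by (rule union_with_inside)
  have "x \<in> inside (curve \<gamma> (X \<union> Z)) \<or> x \<in> inside (curve \<gamma> (Y \<union> Z))"
  proof (rule ccontr)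
    assume "\<not> ?thesis"
    moreover have "x \<notin> curve \<gamma> (X \<union> Z)" "x \<notin> curve \<gamma> (Y \<union> Z)"
      using x assms noXY unfolding curve_Un by blast+
    ultimately have "x \<in> outside (curve \<gamma> (X \<union> Z))" "x \<in> outside (curve \<gamma> (Y \<union> Z))"
      using out[of "curve \<gamma> (X \<union> Z)"] out[of "curve \<gamma> (Y \<union> Z)"] by blast+
    moreover have "y \<in> outside (curve \<gamma> (X \<union> Z))" "y \<in> outside (curve \<gamma> (Y \<union> Z))"
      using out[of "curve \<gamma> (X \<union> Z)"] out[of "curve \<gamma> (Y \<union> Z)"] y by (auto simp: disc_def)
    moreover have "outside S \<subseteq> - S" for S :: "complex set" using outside_no_overlap by blast
    ultimately have cc: "connected_component (- curve \<gamma> (X \<union> Z)) x y"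
      "connected_component (- curve \<gamma> (Y \<union> Z)) x y"
      using XZ.Jordan(4) YZ.Jordan(4) unfolding connected_component_def by meson+
    obtain g3 where g3: "arc g3" "path_image g3 = curve \<gamma> Z"
      using path_curve_arc[OF plane paths(3) ab edges(3)] by metis
    \<comment> \<open>Janiszewski's theorem needs the two closed curves to meet in a connected set,
      here the arc \<open>Z\<close>. Then all three paths together do not separate \<open>x\<close>
      from \<open>y\<close>, although \<open>x\<close> is inside the curve of
      \<open>X \<union> Y\<close> and \<open>y\<close> is not.\<close>
    have "curve \<gamma> (X \<union> Z) \<inter> curve \<gamma> (Y \<union> Z) = curve \<gamma> Z"
      using curves_Int unfolding curve_Un by blast
    then have "connected (curve \<gamma> (X \<union> Z) \<inter> curve \<gamma> (Y \<union> Z))"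
      using g3 by (metis connected_path_image arc_imp_path)
    moreover have "compact (curve \<gamma> (X \<union> Z))" "closed (curve \<gamma> (Y \<union> Z))"
      using compact_curve[OF plane] edges compact_imp_closed by (meson Un_least)+
    ultimately have "connected_component (- (curve \<gamma> (X \<union> Z) \<union> curve \<gamma> (Y \<union> Z))) x y"
      using Janiszewski cc by blast
    then have "connected_component (- curve \<gamma> (X \<union> Y)) x y"
      by (rule connected_component_of_subset) (auto simp: curve_Un)
    then have "y \<in> ?I" using inside_same_component x by blast
    then show False using y by (simp add: disc_def)
  qed
  \<comment> \<open>The interior of the old cycle is connected and avoids the curve of
    \<open>F\<close>, so all of it follows \<open>x\<close> to the inside; taking closures adds the
    boundary.\<close>
  moreover have "disc \<gamma> (X \<union> Y) \<subseteq> disc \<gamma> F"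
    if "x \<in> inside (curve \<gamma> F)" "F \<subseteq> X \<union> Y \<union> Z" for F
  proof -
    have "curve \<gamma> F \<subseteq> curve \<gamma> (X \<union> Y) \<union> curve \<gamma> Z" using that(2) by (auto simp: curve_def)
    then have "?I \<inter> curve \<gamma> F = {}" using noXY assms by blast
    then have "?I \<subseteq> inside (curve \<gamma> F)"
      using connected_subset_inside[OF Jordan(2)] x that(1) by blast
    then have "closure ?I \<subseteq> closure (inside (curve \<gamma> F))" by (rule closure_mono)
    moreover have "closed (curve \<gamma> F)"
      using compact_curve[OF plane, of F] that(2) edges compact_imp_closed by blast
    then have "closure (inside (curve \<gamma> F)) \<subseteq> disc \<gamma> F"
      using closure_inside_subset unfolding disc_def by blast
    moreover have "disc \<gamma> (X \<union> Y) \<subseteq> closure ?I"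
      using Jordan(5) unfolding disc_def frontier_def closure_def by blast
    ultimately show ?thesis by blast
  qed
  ultimately show ?thesis by blast
qed

end

section \<open>Separations and ears\<close>

text \<open>For a graph with at least three vertices this means being disconnected or having a cut
  vertex. Both cases are treated alike, as two graphs glued at \<open>x\<close>.\<close>

definition separation :: "'a set \<Rightarrow> 'a set set \<Rightarrow> 'a set \<Rightarrow> 'a set \<Rightarrow> 'a \<Rightarrow> bool" where
  "separation V E A B x \<longleftrightarrow>
     A \<union> B = V \<and> A \<inter> B = {x} \<and> A \<noteq> V \<and> B \<noteq> V \<and> (\<forall>e\<in>E. e \<subseteq> A \<or> e \<subseteq> B)"

lemma path_meets_separator:
  assumes "xs \<noteq> []" "hd xs \<in> A" "last xs \<in> B" "\<And>e. e \<in> path_edges xs \<Longrightarrow> e \<subseteq> A \<or> e \<subseteq> B" "A \<inter> B = {x}"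
  shows "x \<in> set xs"
  using assms
proof (induction xs rule: path_edges.induct)
  case (1 u v zs)
  show ?case
  proof (cases "v \<in> A")
    case True
    then have "x \<in> set (v # zs)" using 1 by auto
    then show ?thesis by simp
  next
    case False
    then have "u \<in> A \<inter> B" using 1(3) 1(5)[of "{u, v}"] by auto
    then show ?thesis using 1(6) by simp
  qed
qed auto

text \<open>If the cycle had vertices strictly on both sides, both of its paths between them would
  pass through \<open>x\<close>, although they meet only at their ends.\<close>

lemma cyc_separation:
  assumes "cyc D" "\<And>e. e \<in> D \<Longrightarrow> e \<subseteq> A \<or> e \<subseteq> B" "A \<inter> B = {x}"
  shows "(\<forall>e\<in>D. e \<subseteq> A) \<or> (\<forall>e\<in>D. e \<subseteq> B)"
proof (rule ccontr)
  assume "\<not> ?thesis"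
  then obtain e f where ef: "e \<in> D" "\<not> e \<subseteq> A" "f \<in> D" "\<not> f \<subseteq> B" by blast
  then obtain a b where ab: "a \<in> f" "a \<notin> B" "b \<in> e" "b \<notin> A" by blast
  have "a \<in> A" "b \<in> B" using assms(2) ef ab by blast+
  have "a \<noteq> b" "a \<in> \<Union>D" "b \<in> \<Union>D" using \<open>a \<in> A\<close> ab ef by auto
  then obtain xs ys where *: "path_betw a xs b" "path_betw a ys b" "set xs \<inter> set ys = {a, b}"
    "D = path_edges xs \<union> path_edges ys"
    using cyc_split[OF assms(1)] by metis
  have "x \<in> set us" if "path_betw a us b" "path_edges us \<subseteq> D" for us
    using path_meets_separator[of us A B x] that \<open>a \<in> A\<close> \<open>b \<in> B\<close> assms(2,3)
    unfolding path_betw_def by blast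
  then have "x \<in> {a, b}" using * by blast
  then show False using \<open>a \<in> A\<close> \<open>b \<in> B\<close> ab assms(3) by blast
qed

text \<open>The path grows along the walk; whenever the walk returns to a vertex of the path, the
  path is cut back to that vertex.\<close>

lemma rtrancl_path:
  assumes "(v, w) \<in> {(x, y). x \<in> W \<and> y \<in> W \<and> {x, y} \<in> E}\<^sup>*" "v \<in> W"
  shows "\<exists>xs. path_betw v xs w \<and> set xs \<subseteq> W \<and> path_edges xs \<subseteq> E"
  using assms
proof (induction rule: rtrancl_induct)
  case base
  then show ?case by (intro exI[of _ "[v]"]) (auto simp: path_betw_def)
next
  case (step y z)
  then obtain xs where xs: "path_betw v xs y" "set xs \<subseteq> W" "path_edges xs \<subseteq> E" by blast
  show ?case
  proof (cases "z \<in> set xs")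
    case True
    then obtain as bs where ab: "xs = as @ z # bs" by (metis split_list)
    have "path_edges (as @ [z]) \<subseteq> path_edges xs"
    proof (cases "bs = []")
      case True
      then show ?thesis by (simp add: ab)
    next
      case False
      then show ?thesis using path_edges_append[of "as @ [z]" bs] by (auto simp: ab)
    qed
    moreover have "path_betw v (as @ [z]) z"
      using xs(1) by (cases as) (auto simp: ab path_betw_def)
    ultimately show ?thesis using xs ab by (intro exI[of _ "as @ [z]"]) auto
  next
    case False
    have "path_betw v (xs @ [z]) z" using xs(1) False by (auto simp: path_betw_def)
    moreover have "path_edges (xs @ [z]) = insert {y, z} (path_edges xs)"
      using xs(1) by (auto simp: path_betw_def path_edges_append)
    ultimately show ?thesis using xs step(2) by (intro exI[of _ "xs @ [z]"]) auto
  qed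
qed

text \<open>The component of \<open>d\<close> outside \<open>U\<close> is attached to
  \<open>U\<close> at two vertices at least, since otherwise it would form one side of a separation.
  A path through the component joins two attachments.\<close>

lemma ear_vertex:
  assumes edges: "\<And>e. e \<in> E \<Longrightarrow> e \<subseteq> V \<and> card e = 2"
    and nonsep: "\<And>A B x. \<not> separation V E A B x"
    and U: "U \<subseteq> V" "u1 \<in> U" "u2 \<in> U" "u1 \<noteq> u2" and d: "d \<in> V - U"
  obtains a b zs where "a \<noteq> b" "path_betw a zs b" "path_edges zs \<subseteq> E"
    "set zs \<inter> U = {a, b}" "\<And>e. e \<in> path_edges zs \<Longrightarrow> \<not> e \<subseteq> U"
proof -
  define r where "r = {(x, y). x \<in> V - U \<and> y \<in> V - U \<and> {x, y} \<in> E}"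
  define C where "C = {v. (d, v) \<in> r\<^sup>*}"
  have sym: "sym r" by (auto simp: sym_def r_def insert_commute)
  have C: "C \<subseteq> V - U"
  proof
    fix v assume "v \<in> C"
    then have "(d, v) \<in> r\<^sup>*" by (simp add: C_def)
    then show "v \<in> V - U" using d by (induction rule: rtrancl_induct) (auto simp: r_def)
  qed
  have "d \<in> C" by (simp add: C_def)
  have step: "w \<in> C" if "v \<in> C" "{v, w} \<in> E" "w \<notin> U" for v w
  proof -
    have "(v, w) \<in> r" using that C edges[OF that(2)] by (auto simp: r_def)
    then show ?thesis using that(1) by (auto simp: C_def)
  qed
  define T where "T = {x \<in> U. \<exists>v\<in>C. {v, x} \<in> E}"
  have "\<exists>x\<in>T. \<exists>y\<in>T. x \<noteq> y"
  proof (rule ccontr)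
    assume "\<not> ?thesis"
    \<comment> \<open>If there is no attachment at all, any vertex of \<open>U\<close> serves as the
      shared vertex.\<close>
    then obtain x where x: "x \<in> U" "T \<subseteq> {x}"
      using U(2) unfolding T_def by blast
    have "e \<subseteq> V - C \<or> e \<subseteq> insert x C" if eE: "e \<in> E" for e
    proof (cases "e \<inter> C = {}")
      case True
      then show ?thesis using edges[OF eE] by blast
    next
      case False
      then obtain v where "v \<in> e" "v \<in> C" by blast
      moreover obtain w where w: "e = {v, w}"
        using edges[OF eE] \<open>v \<in> e\<close> by (metis card_2_iff insertE insert_commute singletonD)
      ultimately have "w \<in> C \<or> w \<in> T" using step eE by (auto simp: T_def)
      then show ?thesis using x \<open>v \<in> C\<close> w by auto
    qed
    moreover have "insert x C \<noteq> V" using U C by auto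
    moreover have "V - C \<noteq> V" using \<open>d \<in> C\<close> d by blast
    moreover have "(V - C) \<union> insert x C = V" "(V - C) \<inter> insert x C = {x}"
      using C x(1) U(1) by auto
    ultimately have "separation V E (V - C) (insert x C) x" by (simp add: separation_def)
    then show False using nonsep by blast
  qed
  then obtain x y v w where xy: "x \<in> U" "y \<in> U" "x \<noteq> y" "v \<in> C" "w \<in> C" "{v, x} \<in> E" "{w, y} \<in> E"
    unfolding T_def by blast
  have "(v, d) \<in> r\<^sup>*" using xy(4) sym_rtrancl[OF sym] by (auto simp: C_def dest: symD)
  then have "(v, w) \<in> r\<^sup>*" using xy(5) by (auto simp: C_def)
  then obtain ps where ps: "path_betw v ps w" "set ps \<subseteq> V - U" "path_edges ps \<subseteq> E"
    using rtrancl_path[of v w "V - U" E] xy(4) C unfolding r_def by blast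
  let ?zs = "x # ps @ [y]"
  have ne: "ps \<noteq> []" "hd ps = v" "last ps = w" using ps(1) by (auto simp: path_betw_def)
  have pe: "path_edges ?zs = insert {x, v} (insert {w, y} (path_edges ps))"
    using ne path_edges_append[of ps "[y]"] by (simp add: path_edges_Cons)
  show ?thesis
  proof
    show "x \<noteq> y" by fact
    show "path_betw x ?zs y" using ps xy by (auto simp: path_betw_def)
    show "path_edges ?zs \<subseteq> E" using pe ps(3) xy by (auto simp: insert_commute)
    show "set ?zs \<inter> U = {x, y}" using ps(2) xy by auto
    fix e assume e: "e \<in> path_edges ?zs"
    have "e \<inter> set ps \<noteq> {}"
    proof (cases "e \<in> path_edges ps")
      case True
      then have "e \<subseteq> set ps" "e \<noteq> {}" using path_edges_subset edges ps(3) by fastforce+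
      then show ?thesis by blast
    next
      case False
      then show ?thesis using e pe path_betw_in[OF ps(1)] by auto
    qed
    then show "\<not> e \<subseteq> U" using ps(2) by blast
  qed
qed

text \<open>An edge with both ends in \<open>U\<close> is itself an ear; any other edge has an end
  from which an ear can be grown.\<close>

lemma ear_edge:
  assumes edges: "\<And>e. e \<in> E \<Longrightarrow> e \<subseteq> V \<and> card e = 2"
    and nonsep: "\<And>A B x. \<not> separation V E A B x"
    and U: "U \<subseteq> V" "u1 \<in> U" "u2 \<in> U" "u1 \<noteq> u2"
    and F: "\<Union>F \<subseteq> U" and e: "e \<in> E - F"
  obtains a b zs where "a \<noteq> b" "path_betw a zs b" "path_edges zs \<subseteq> E"
    "set zs \<inter> U = {a, b}" "path_edges zs \<inter> F = {}"
proof (cases "e \<subseteq> U")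
  case True
  obtain a b where "e = {a, b}" "a \<noteq> b" using edges e by (metis DiffD1 card_2_iff)
  then show ?thesis using that[of a b "[a, b]"] e True by (auto simp: path_betw_def)
next
  case False
  then obtain d where "d \<in> V - U" using edges e by blast
  then obtain a b zs where *: "a \<noteq> b" "path_betw a zs b" "path_edges zs \<subseteq> E"
    "set zs \<inter> U = {a, b}" "\<And>e. e \<in> path_edges zs \<Longrightarrow> \<not> e \<subseteq> U"
    using ear_vertex[OF edges nonsep U] by metis
  then have "path_edges zs \<inter> F = {}" using F by blast
  then show ?thesis using that * by blast
qed

section \<open>Triangles and the bound across a separation\<close>

definition triangles :: "'a set set \<Rightarrow> 'a set set set" where
  "triangles E = {D. D \<subseteq> E \<and> cyc D \<and> card D = 3}"

lemma finite_triangles: "finite E \<Longrightarrow> finite (triangles E)"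
  unfolding triangles_def by simp

lemma card_triangles_Un:
  assumes "finite E" "E1 \<subseteq> E" "E2 \<subseteq> E" "\<And>D. D \<subseteq> E1 \<inter> E2 \<Longrightarrow> \<not> cyc D"
  shows "card (triangles E1) + card (triangles E2) \<le> card (triangles E)"
proof -
  have "triangles E1 \<inter> triangles E2 = {}" using assms(4) by (auto simp: triangles_def)
  then have "card (triangles E1) + card (triangles E2) = card (triangles E1 \<union> triangles E2)"
    using finite_triangles finite_subset assms(1-3) by (metis card_Un_disjoint)
  also have "\<dots> \<le> card (triangles E)"
    using assms finite_triangles by (intro card_mono) (auto simp: triangles_def)
  finally show ?thesis .
qed

text \<open>The vertex \<open>x\<close> is counted on both sides, and its extra 6 pays for the
  second constant 6. The parameter \<open>k\<close> carries the length of an outer cycle that lies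
  in \<open>A\<close>, and is 0 if there is none.\<close>

lemma separation_bound:
  assumes "finite V" "finite E" "\<And>e. e \<in> E \<Longrightarrow> card e = 2" "separation V E A B x"
    "k + 4 * card {e\<in>E. e \<subseteq> A} + 6 \<le> 6 * card A + 3 * card (triangles {e\<in>E. e \<subseteq> A})"
    "4 * card {e\<in>E. e \<subseteq> B} + 6 \<le> 6 * card B + 3 * card (triangles {e\<in>E. e \<subseteq> B})"
  shows "k + 4 * card E + 6 \<le> 6 * card V + 3 * card (triangles E)"
proof -
  have AB: "A \<union> B = V" "A \<inter> B = {x}" "\<And>e. e \<in> E \<Longrightarrow> e \<subseteq> A \<or> e \<subseteq> B"
    using assms(4) by (auto simp: separation_def)
  have V: "card A + card B = card V + 1"
    using card_Un_Int[of A B] AB assms(1) by (metis card.empty card_insert_disjoint empty_iff finite.emptyI finite_Un One_nat_def)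
  have none: "e \<notin> E" if "e \<subseteq> A" "e \<subseteq> B" for e
  proof
    assume "e \<in> E"
    moreover have "e \<subseteq> {x}" using that AB by blast
    then have "card e \<le> 1" by (metis card_mono finite.emptyI finite.insertI is_singletonI is_singleton_altdef)
    ultimately show False using assms(3) by fastforce
  qed
  have "card {e\<in>E. e \<subseteq> A} + card {e\<in>E. e \<subseteq> B} = card ({e\<in>E. e \<subseteq> A} \<union> {e\<in>E. e \<subseteq> B})"
    using assms(2) none by (intro card_Un_disjoint[symmetric]) auto
  also have "{e\<in>E. e \<subseteq> A} \<union> {e\<in>E. e \<subseteq> B} = E" using AB by blast
  finally have "card {e\<in>E. e \<subseteq> A} + card {e\<in>E. e \<subseteq> B} = card E" .
  moreover have "\<not> cyc D" if "D \<subseteq> {e\<in>E. e \<subseteq> A} \<inter> {e\<in>E. e \<subseteq> B}" for D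
  proof -
    have "D = {}" using that none by blast
    then show ?thesis using cyc_card_Union[of D] by auto
  qed
  then have "card (triangles {e\<in>E. e \<subseteq> A}) + card (triangles {e\<in>E. e \<subseteq> B}) \<le> card (triangles E)"
    by (intro card_triangles_Un assms(2)) auto
  ultimately show ?thesis using V assms(5,6) by linarith
qed

section \<open>Cutting a disc along an ear\<close>

definition edges_in :: "('a set \<Rightarrow> real \<Rightarrow> complex) \<Rightarrow> 'a set set \<Rightarrow> complex set \<Rightarrow> 'a set set" where
  "edges_in \<gamma> E S = {e\<in>E. path_image (\<gamma> e) \<subseteq> S}"

definition verts_in :: "('a \<Rightarrow> complex) \<Rightarrow> 'a set \<Rightarrow> complex set \<Rightarrow> 'a set" where
  "verts_in p V S = {v\<in>V. p v \<in> S}"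

lemma edge_in_verts_in:
  assumes "plane V E p \<gamma>" "e \<in> edges_in \<gamma> E S"
  shows "e \<subseteq> verts_in p V S"
proof -
  have e: "e \<in> E" "path_image (\<gamma> e) \<subseteq> S" using assms(2) by (auto simp: edges_in_def)
  have "e \<subseteq> V" using e(1) assms(1) by (auto simp: plane_def)
  moreover have "p ` e \<subseteq> S" using plane_image_vertices[OF assms(1) e(1)] e(2) by blast
  ultimately show ?thesis by (auto simp: verts_in_def)
qed

lemma plane_in:
  assumes "plane V E p \<gamma>"
  shows "plane (verts_in p V S) (edges_in \<gamma> E S) p \<gamma>"
proof (rule plane_subgraph[OF assms])
  show "e \<subseteq> verts_in p V S" if "e \<in> edges_in \<gamma> E S" for e
    using edge_in_verts_in[OF assms that] .
qed (auto simp: verts_in_def edges_in_def)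

lemma theta_of_ear:
  assumes "plane V E p \<gamma>" "cyc D" "D \<subseteq> E" "a \<noteq> b" "path_betw a zs b" "path_edges zs \<subseteq> E"
    "set zs \<inter> \<Union>D = {a, b}" "path_edges zs \<inter> D = {}"
  obtains xs ys where "theta V E p \<gamma> a b xs ys zs" "D = path_edges xs \<union> path_edges ys"
proof -
  have "a \<in> \<Union>D" "b \<in> \<Union>D" using assms(7) by auto
  then obtain xs ys where *: "path_betw a xs b" "path_betw a ys b" "set xs \<inter> set ys = {a, b}"
    "D = path_edges xs \<union> path_edges ys" "path_edges xs \<inter> path_edges ys = {}"
    using cyc_split[OF assms(2)] assms(4) by metis
  have "\<Union>D = set xs \<union> set ys"
    using Union_path_edges[OF path_betw_length[OF *(1) assms(4)]]
      Union_path_edges[OF path_betw_length[OF *(2) assms(4)]] *(4) by auto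
  then have "set xs \<inter> set zs = {a, b}" "set ys \<inter> set zs = {a, b}"
    using assms(7) path_betw_in[OF *(1)] path_betw_in[OF *(2)] by auto
  then have "theta V E p \<gamma> a b xs ys zs"
    using assms * by unfold_locales auto
  then show ?thesis using that *(4) by blast
qed

context theta
begin

lemma cyc_XZ: "cyc (X \<union> Z)"
proof (rule cyc_join[OF paths(1,3) ab Int(2)])
  show "xs \<noteq> [a, b] \<or> zs \<noteq> [a, b]" using disj(2) by auto
qed

lemma finite_sets: "finite V" "finite E"
  using plane_finite[OF plane] by auto

text \<open>The two discs cut off by \<open>Z\<close> overlap exactly in \<open>Z\<close>, so all the counts are additive.\<close>

lemma disc_bound:
  assumes inE: "\<And>e. e \<in> E \<Longrightarrow> path_image (\<gamma> e) \<subseteq> disc \<gamma> (X \<union> Y)"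
    and inV: "\<And>v. v \<in> V \<Longrightarrow> p v \<in> disc \<gamma> (X \<union> Y)"
    and ins: "curve \<gamma> Z \<inter> inside (curve \<gamma> (X \<union> Y)) \<noteq> {}"
    and IH: "\<And>V' E' D. plane V' E' p \<gamma> \<Longrightarrow> V' \<noteq> {} \<Longrightarrow> V' \<subseteq> V \<Longrightarrow> E' \<subset> E \<Longrightarrow> D \<subseteq> E' \<Longrightarrow> cyc D \<Longrightarrow>
        (\<And>e. e \<in> E' \<Longrightarrow> path_image (\<gamma> e) \<subseteq> disc \<gamma> D) \<Longrightarrow> (\<And>v. v \<in> V' \<Longrightarrow> p v \<in> disc \<gamma> D) \<Longrightarrow>
        4 * card E' + card D + 6 \<le> 6 * card V' + 3 * card (triangles E')"
  shows "4 * card E + card (X \<union> Y) + 6 \<le> 6 * card V + 3 * card (triangles E)"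
proof -
  interpret YZ: theta V E p \<gamma> b a "rev ys" "rev xs" "rev zs"
    using plane ab paths edges Int disj by unfold_locales (auto simp: path_edges_rev path_betw_rev)
  let ?D1 = "X \<union> Z" and ?D2 = "Y \<union> Z"
  let ?E1 = "edges_in \<gamma> E (disc \<gamma> ?D1)" and ?E2 = "edges_in \<gamma> E (disc \<gamma> ?D2)"
  let ?V1 = "verts_in p V (disc \<gamma> ?D1)" and ?V2 = "verts_in p V (disc \<gamma> ?D2)"
  note ds = disc_split[OF ins]
  have cyc2: "cyc ?D2" using YZ.cyc_XZ by (simp add: path_edges_rev)
  have on: "e \<in> edges_in \<gamma> E (disc \<gamma> F)" if "e \<in> F" "F \<subseteq> E" for e F
  proof -
    have "path_image (\<gamma> e) \<subseteq> curve \<gamma> F" unfolding curve_def using that(1) by (rule UN_upper)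
    then show ?thesis using that by (auto simp: edges_in_def disc_def)
  qed
  have Dsub: "?D1 \<subseteq> E" "?D2 \<subseteq> E" using edges by auto
  have E_Un: "?E1 \<union> ?E2 = E"
  proof -
    have "e \<in> ?E1 \<or> e \<in> ?E2" if "e \<in> E" for e
    proof (cases "e \<in> ?D1 \<or> e \<in> ?D2")
      case True
      then show ?thesis using on[of e ?D1] on[of e ?D2] Dsub by fast
    next
      case False
      \<comment> \<open>An edge on none of the three paths meets one of the two smaller discs and
        then cannot leave it.\<close>
      have "open_edge p \<gamma> e \<subseteq> disc \<gamma> (X \<union> Y)"
        using inE[OF that] by (auto simp: open_edge_def)
      then have "open_edge p \<gamma> e \<inter> disc \<gamma> ?D1 \<noteq> {} \<or> open_edge p \<gamma> e \<inter> disc \<gamma> ?D2 \<noteq> {}"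
        using ds(1) open_edge(2)[OF plane that] by blast
      then show ?thesis
        using edge_in_disc(1)[OF plane that Dsub(1)] edge_in_disc(1)[OF plane that Dsub(2)] False that
        by (auto simp: edges_in_def)
    qed
    then show ?thesis by (auto simp: edges_in_def)
  qed
  have E_Int: "?E1 \<inter> ?E2 = Z"
  proof
    show "?E1 \<inter> ?E2 \<subseteq> Z"
    proof
      fix e assume "e \<in> ?E1 \<inter> ?E2"
      then have "e \<in> E" "path_image (\<gamma> e) \<subseteq> curve \<gamma> Z" using ds(2) by (auto simp: edges_in_def)
      then show "e \<in> Z" using edge_in_curve[OF plane _ edges(3)] by simp
    qed
    show "Z \<subseteq> ?E1 \<inter> ?E2"
      using on[OF _ Dsub(1)] on[OF _ Dsub(2)] by (meson IntI UnCI subsetI)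
  qed
  have V_Un: "?V1 \<union> ?V2 = V" using inV ds(1) by (auto simp: verts_in_def)
  have UZ: "\<Union>Z = set zs" using Union_path_edges[OF path_betw_length[OF paths(3) ab]] .
  have "\<Union>E \<subseteq> V" using plane by (auto simp: plane_def)
  then have zsV: "set zs \<subseteq> V" using UZ Union_mono[OF edges(3)] by simp
  have "?V1 \<inter> ?V2 = {v\<in>V. p v \<in> curve \<gamma> Z}" using ds(2) by (auto simp: verts_in_def)
  also have "\<dots> = set zs" using vertex_on_curve[OF plane edges(3)] UZ zsV by blast
  finally have V_Int: "?V1 \<inter> ?V2 = set zs" .
  have finE: "finite ?E1" "finite ?E2" and finV: "finite ?V1" "finite ?V2"
    using finite_sets by (simp_all add: edges_in_def verts_in_def)
  have cE: "card E + card Z = card ?E1 + card ?E2"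
    using card_Un_Int[OF finE] unfolding E_Un E_Int by (rule sym)
  have cV: "card V + (card Z + 1) = card ?V1 + card ?V2"
    using card_Un_Int[OF finV] unfolding V_Un V_Int card_path_betw[OF paths(3)] by (rule sym)
  have cD: "card ?D1 = card X + card Z" "card ?D2 = card Y + card Z" "card (X \<union> Y) = card X + card Y"
    using disj by (simp_all add: card_Un_disjoint)
  have tri: "card (triangles ?E1) + card (triangles ?E2) \<le> card (triangles E)"
  proof (rule card_triangles_Un[OF finite_sets(2)])
    show "?E1 \<subseteq> E" "?E2 \<subseteq> E" by (auto simp: edges_in_def)
    show "\<not> cyc D" if "D \<subseteq> ?E1 \<inter> ?E2" for D
      using no_cyc_path[of zs D] paths(3) that E_Int by (auto simp: path_betw_def)
  qed
  have ne: "path_edges us \<noteq> {}" if "path_betw a us b" for us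
    using path_betw_length[OF that ab] by (cases us rule: path_edges.cases) auto
  have D12: "X \<subseteq> ?E1" "Y \<subseteq> ?E2" "?D1 \<subseteq> ?E1" "?D2 \<subseteq> ?E2" using on[OF _ Dsub(1)] on[OF _ Dsub(2)] by (meson UnCI subsetI)+
  \<comment> \<open>Each side misses one of the two outer paths, so both have strictly fewer
    edges.\<close>
  then have "X \<inter> ?E2 = {}" "Y \<inter> ?E1 = {}" using E_Int disj by blast+
  then have sub: "?E1 \<subset> E" "?E2 \<subset> E"
    using ne[OF paths(1)] ne[OF paths(2)] edges(1,2) by (auto simp: edges_in_def)
  have VV: "?V1 \<noteq> {}" "?V2 \<noteq> {}" using V_Int paths(3) by (auto simp: path_betw_def)
  have "4 * card ?E1 + card ?D1 + 6 \<le> 6 * card ?V1 + 3 * card (triangles ?E1)"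
    by (rule IH[OF plane_in[OF plane] VV(1) _ sub(1) D12(3) cyc_XZ]) (auto simp: verts_in_def edges_in_def)
  moreover have "4 * card ?E2 + card ?D2 + 6 \<le> 6 * card ?V2 + 3 * card (triangles ?E2)"
    by (rule IH[OF plane_in[OF plane] VV(2) _ sub(2) D12(4) cyc2]) (auto simp: verts_in_def edges_in_def)
  \<comment> \<open>With z = |Z|, the double count of the cut adds 4z for edges and 2z for the two
    cycle lengths on the left, and 6(z + 1) for vertices on the right. The terms in z cancel, and
    the remaining 6 absorbs the second constant.\<close>
  ultimately show ?thesis using cE cV cD tri by linarith
qed

end

section \<open>The density bound\<close>

lemma path_betw_edges_nonempty: "path_betw a us b \<Longrightarrow> a \<noteq> b \<Longrightarrow> path_edges us \<noteq> {}"
  using path_betw_length[of a us b] by (cases us rule: path_edges.cases) auto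

text \<open>A cycle whose disc contains as many edges as possible encloses a nonseparable graph.\<close>

lemma nonseparable_enclosed:
  assumes pl: "plane V E p \<gamma>" and nonsep: "\<And>A B x. \<not> separation V E A B x"
    and "cyc D0" "D0 \<subseteq> E"
  obtains D where "cyc D" "D \<subseteq> E" "\<And>e. e \<in> E \<Longrightarrow> path_image (\<gamma> e) \<subseteq> disc \<gamma> D"
    "\<And>v. v \<in> V \<Longrightarrow> p v \<in> disc \<gamma> D"
proof -
  let ?m = "\<lambda>D. card (edges_in \<gamma> E (disc \<gamma> D))"
  have edges: "e \<subseteq> V \<and> card e = 2" if "e \<in> E" for e using pl that by (auto simp: plane_def)
  have fin: "finite E" using plane_finite[OF pl] by simp
  have "\<exists>D. (cyc D \<and> D \<subseteq> E) \<and> (\<forall>D'. (cyc D' \<and> D' \<subseteq> E) \<longrightarrow> ?m D' \<le> ?m D)"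
  proof (rule ex_has_greatest_nat)
    show "cyc D0 \<and> D0 \<subseteq> E" using assms by simp
    show "\<forall>D. cyc D \<and> D \<subseteq> E \<longrightarrow> ?m D < Suc (card E)"
      using fin by (auto simp: edges_in_def less_Suc_eq_le intro: card_mono)
  qed
  then obtain D where D: "cyc D" "D \<subseteq> E" and max: "\<And>D'. cyc D' \<Longrightarrow> D' \<subseteq> E \<Longrightarrow> ?m D' \<le> ?m D"
    by blast
  let ?F = "edges_in \<gamma> E (disc \<gamma> D)" and ?U = "verts_in p V (disc \<gamma> D)"
  have FU: "\<Union>?F \<subseteq> ?U" using edge_in_verts_in[OF pl] by blast
  have DF: "D \<subseteq> ?F" using D by (auto simp: edges_in_def disc_def curve_def)
  have U: "?U \<subseteq> V" by (auto simp: verts_in_def)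
  obtain u1 u2 where u: "u1 \<in> ?U" "u2 \<in> ?U" "u1 \<noteq> u2"
  proof -
    obtain e where "e \<in> D" using D cyc_card_Union[of D] by fastforce
    moreover obtain u v where "e = {u, v}" "u \<noteq> v" using cyc_edgeD[OF D(1) \<open>e \<in> D\<close>] by metis
    ultimately show ?thesis using DF FU that[of u v] by blast
  qed
  have no_out: "E - ?F = {}"
  proof (rule ccontr)
    assume "E - ?F \<noteq> {}"
    then obtain e where "e \<in> E - ?F" by blast
    then obtain a b zs where z: "a \<noteq> b" "path_betw a zs b" "path_edges zs \<subseteq> E"
      "set zs \<inter> ?U = {a, b}" "path_edges zs \<inter> ?F = {}"
      using ear_edge[OF edges nonsep U u FU] by metis
    \<comment> \<open>The open edges of the ear avoid the closed disc, so their closures avoid its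
      interior, which is open.\<close>
    have miss: "path_image (\<gamma> e) \<inter> inside (curve \<gamma> D) = {}" if "e \<in> path_edges zs" for e
    proof -
      have e: "e \<in> E" "e \<notin> D" "\<not> path_image (\<gamma> e) \<subseteq> disc \<gamma> D"
        using that z(3,5) DF by (auto simp: edges_in_def)
      then have "open_edge p \<gamma> e \<inter> disc \<gamma> D = {}"
        using edge_in_disc(1)[OF pl e(1) D(2) e(2)] by blast
      moreover have "open (inside (curve \<gamma> D))"
        using compact_curve[OF pl D(2)] by (simp add: compact_imp_closed open_inside)
      ultimately have "closure (open_edge p \<gamma> e) \<inter> inside (curve \<gamma> D) = {}"
        using open_Int_closure_eq_empty[of "inside (curve \<gamma> D)" "open_edge p \<gamma> e"]
        unfolding disc_def by blast
      then show ?thesis using open_edge(3)[OF pl e(1)] by blast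
    qed
    have "curve \<gamma> (path_edges zs) \<inter> inside (curve \<gamma> D) = {}"
      using miss by (auto simp: curve_def)
    have zs: "\<Union>(path_edges zs) = set zs"
      using Union_path_edges[OF path_betw_length[OF z(2,1)]] .
    \<comment> \<open>The ends of the ear lie in the disc but on an edge that avoids its interior,
      hence on \<open>D\<close> itself.\<close>
    have "set zs \<inter> \<Union>D = {a, b}"
    proof
      show "set zs \<inter> \<Union>D \<subseteq> {a, b}" using z(4) DF FU by blast
      have "v \<in> \<Union>D" if v: "v \<in> {a, b}" for v
      proof -
        have "v \<in> ?U" "v \<in> set zs" using v z(4) by blast+
        then obtain e where e: "e \<in> path_edges zs" "v \<in> e" using zs by blast
        then have "e \<in> E" using z(3) by blast
        then have "p v \<in> path_image (\<gamma> e)" using plane_image_vertices[OF pl] e(2) by blast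
        then have "p v \<notin> inside (curve \<gamma> D)" using miss[OF e(1)] by blast
        moreover have "v \<in> V" "p v \<in> disc \<gamma> D" using \<open>v \<in> ?U\<close> by (auto simp: verts_in_def)
        ultimately show ?thesis using vertex_on_curve[OF pl D(2)] by (auto simp: disc_def)
      qed
      moreover have "{a, b} \<subseteq> set zs" unfolding z(4)[symmetric] by (rule Int_lower1)
      ultimately show "{a, b} \<subseteq> set zs \<inter> \<Union>D" by (intro Int_greatest subsetI) auto
    qed
    moreover have "path_edges zs \<inter> D = {}" using z(5) DF by blast
    ultimately obtain xs ys where th: "theta V E p \<gamma> a b xs ys zs" and Dxy: "D = path_edges xs \<union> path_edges ys"
      using theta_of_ear[OF pl D z(1-3)] by metis
    interpret theta V E p \<gamma> a b xs ys zs by (rule th)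
    interpret YX: theta V E p \<gamma> a b ys xs zs
      using plane ab paths edges Int disj by unfold_locales blast+
    \<comment> \<open>A cycle through the ear with a larger disc encloses all edges enclosed before
      and those of the ear, against the choice of \<open>D\<close>.\<close>
    have bigger: False if F: "cyc F" "F \<subseteq> E" "Z \<subseteq> F" "disc \<gamma> D \<subseteq> disc \<gamma> F" for F
    proof -
      have "path_image (\<gamma> e) \<subseteq> disc \<gamma> F" if "e \<in> Z" for e
        unfolding disc_def curve_def using that F(3) by blast
      then have "?F \<union> Z \<subseteq> edges_in \<gamma> E (disc \<gamma> F)"
        using F(4) edges(3) unfolding edges_in_def by blast
      then have "card (?F \<union> Z) \<le> ?m F"
        using fin by (intro card_mono) (auto simp: edges_in_def)
      also have "\<dots> \<le> card ?F" using max F by simp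
      finally have "card (?F \<union> Z) \<le> card ?F" .
      moreover have "finite ?F" using fin by (auto simp: edges_in_def)
      ultimately have "?F \<union> Z = ?F" by (intro card_seteq[symmetric]) auto
      then show False using z(5) path_betw_edges_nonempty[OF z(2,1)] by blast
    qed
    have "disc \<gamma> D \<subseteq> disc \<gamma> (X \<union> Z) \<or> disc \<gamma> D \<subseteq> disc \<gamma> (Y \<union> Z)"
      using disc_grows \<open>curve \<gamma> Z \<inter> inside (curve \<gamma> D) = {}\<close> Dxy by simp
    then show False
      using bigger[OF cyc_XZ] bigger[OF YX.cyc_XZ] edges by blast
  qed
  \<comment> \<open>All edges are enclosed by now, and a vertex that is not would yield an ear with
    an edge leaving \<open>?U\<close>.\<close>
  have "V \<subseteq> ?U"
  proof
    fix d assume "d \<in> V"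
    show "d \<in> ?U"
    proof (rule ccontr)
      assume "d \<notin> ?U"
      then obtain a b zs where z: "a \<noteq> b" "path_betw a zs b" "path_edges zs \<subseteq> E"
        "\<And>e. e \<in> path_edges zs \<Longrightarrow> \<not> e \<subseteq> ?U"
        using ear_vertex[OF edges nonsep U u] \<open>d \<in> V\<close> by (metis DiffI)
      then obtain e where e: "e \<in> path_edges zs" using path_betw_edges_nonempty[OF z(2,1)] by blast
      then have "e \<in> ?F" using z(3) no_out by blast
      then show False using z(4)[OF e] FU by blast
    qed
  qed
  then show ?thesis using that[OF D] no_out by (auto simp: edges_in_def verts_in_def)
qed

text \<open>
  Euler's formula without faces: the second bound is what one gets when every inner face of the part
  of the plane enclosed by \<open>D\<close> is a triangle or has length at least six.
\<close>

lemma plane_bounds: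
  assumes "plane V E p \<gamma>" "V \<noteq> {}" "\<forall>D. D \<subseteq> E \<longrightarrow> cyc D \<longrightarrow> card D = 3 \<or> 6 \<le> card D"
  shows "4 * card E + 6 \<le> 6 * card V + 3 * card (triangles E) \<and>
    (\<forall>D. D \<subseteq> E \<longrightarrow> cyc D \<longrightarrow> (\<forall>e\<in>E. path_image (\<gamma> e) \<subseteq> disc \<gamma> D) \<longrightarrow> (\<forall>v\<in>V. p v \<in> disc \<gamma> D) \<longrightarrow>
      4 * card E + card D + 6 \<le> 6 * card V + 3 * card (triangles E))"
  using assms
proof (induction "card V + card E" arbitrary: V E rule: less_induct)
  case less
  note pl = less.prems(1) and len = less.prems(3)
  have fin: "finite V" "finite E" using plane_finite[OF pl] by auto
  have edges: "e \<subseteq> V \<and> card e = 2" if "e \<in> E" for e using pl that by (auto simp: plane_def)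
  show ?case
  proof (cases "\<exists>A B x. separation V E A B x")
    case True
    then obtain A B x where sep: "separation V E A B x" by blast
    have sub: "plane A {e\<in>E. e \<subseteq> A} p \<gamma>" "A \<noteq> {}" "card A + card {e\<in>E. e \<subseteq> A} < card V + card E"
      if "separation V E A B x" for A B
    proof -
      have "A \<subset> V" "x \<in> A" using that by (auto simp: separation_def)
      then show "A \<noteq> {}" by blast
      show "plane A {e\<in>E. e \<subseteq> A} p \<gamma>"
        by (rule plane_subgraph[OF pl]) (use \<open>A \<subset> V\<close> in auto)
      have "card {e\<in>E. e \<subseteq> A} \<le> card E" using fin by (intro card_mono) auto
      then show "card A + card {e\<in>E. e \<subseteq> A} < card V + card E"
        using psubset_card_mono[OF fin(1) \<open>A \<subset> V\<close>] by simp
    qed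
    have sep': "separation V E B A x" using sep by (auto simp: separation_def)
    have IH: "4 * card {e\<in>E. e \<subseteq> A} + 6 \<le> 6 * card A + 3 * card (triangles {e\<in>E. e \<subseteq> A})"
      "\<And>D. D \<subseteq> {e\<in>E. e \<subseteq> A} \<Longrightarrow> cyc D \<Longrightarrow> (\<forall>e\<in>E. path_image (\<gamma> e) \<subseteq> disc \<gamma> D) \<Longrightarrow>
        (\<forall>v\<in>V. p v \<in> disc \<gamma> D) \<Longrightarrow>
        card D + 4 * card {e\<in>E. e \<subseteq> A} + 6 \<le> 6 * card A + 3 * card (triangles {e\<in>E. e \<subseteq> A})"
      if "separation V E A B x" for A B
    proof -
      have lenA: "\<forall>D. D \<subseteq> {e\<in>E. e \<subseteq> A} \<longrightarrow> cyc D \<longrightarrow> card D = 3 \<or> 6 \<le> card D"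
        using len by blast
      note I = less.hyps[OF sub(3)[OF that] sub(1)[OF that] sub(2)[OF that] lenA]
      show "4 * card {e\<in>E. e \<subseteq> A} + 6 \<le> 6 * card A + 3 * card (triangles {e\<in>E. e \<subseteq> A})"
        using I by blast
      have "A \<subseteq> V" using that by (auto simp: separation_def)
      fix D assume D: "D \<subseteq> {e\<in>E. e \<subseteq> A}" "cyc D"
        and in_disc: "\<forall>e\<in>E. path_image (\<gamma> e) \<subseteq> disc \<gamma> D" "\<forall>v\<in>V. p v \<in> disc \<gamma> D"
      have "\<forall>e\<in>{e\<in>E. e \<subseteq> A}. path_image (\<gamma> e) \<subseteq> disc \<gamma> D" "\<forall>v\<in>A. p v \<in> disc \<gamma> D"
        using in_disc \<open>A \<subseteq> V\<close> by auto
      note I[THEN conjunct2, THEN spec, THEN mp, OF D(1), THEN mp, OF D(2), THEN mp, OF this(1), THEN mp, OF this(2)]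
      then show "card D + 4 * card {e\<in>E. e \<subseteq> A} + 6 \<le> 6 * card A + 3 * card (triangles {e\<in>E. e \<subseteq> A})"
        by simp
    qed
    have c2: "card e = 2" if "e \<in> E" for e using edges that by simp
    show ?thesis
    proof (intro conjI allI impI)
      show "4 * card E + 6 \<le> 6 * card V + 3 * card (triangles E)"
        using separation_bound[OF fin c2 sep, of 0] IH(1)[OF sep] IH(1)[OF sep'] by simp
      fix D assume D: "D \<subseteq> E" "cyc D" "\<forall>e\<in>E. path_image (\<gamma> e) \<subseteq> disc \<gamma> D" "\<forall>v\<in>V. p v \<in> disc \<gamma> D"
      \<comment> \<open>The side containing \<open>D\<close> uses the bound with |D|, the other side
        the bound without it. For this reason both are proved in one induction.\<close>
      have side: "card D + 4 * card E + 6 \<le> 6 * card V + 3 * card (triangles E)"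
        if s: "separation V E A B x" "separation V E B A x" and "\<forall>e\<in>D. e \<subseteq> A" for A B
      proof -
        have "D \<subseteq> {e\<in>E. e \<subseteq> A}" using D(1) that(3) by blast
        then show ?thesis
          using separation_bound[OF fin c2 s(1)] IH(2)[OF s(1)] IH(1)[OF s(2)] D by blast
      qed
      have "(\<forall>e\<in>D. e \<subseteq> A) \<or> (\<forall>e\<in>D. e \<subseteq> B)"
      proof (rule cyc_separation[OF D(2)])
        show "A \<inter> B = {x}" using sep by (simp add: separation_def)
        show "e \<subseteq> A \<or> e \<subseteq> B" if "e \<in> D" for e using sep D(1) that by (auto simp: separation_def)
      qed
      then have "card D + 4 * card E + 6 \<le> 6 * card V + 3 * card (triangles E)"
        using side[OF sep sep'] side[OF sep' sep] by blast
      then show "4 * card E + card D + 6 \<le> 6 * card V + 3 * card (triangles E)" by simp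
    qed
  next
    case False
    then have nonsep: "\<not> separation V E A B x" for A B x by blast
    have disc: "4 * card E + card D + 6 \<le> 6 * card V + 3 * card (triangles E)"
      if D: "D \<subseteq> E" "cyc D" "\<And>e. e \<in> E \<Longrightarrow> path_image (\<gamma> e) \<subseteq> disc \<gamma> D" "\<And>v. v \<in> V \<Longrightarrow> p v \<in> disc \<gamma> D" for D
    proof (cases "E = D")
      case True
      \<comment> \<open>The graph is a bare cycle, possibly with isolated vertices: 5|D| + 6 \<le>
        6|D| once |D| is at least 6, while a triangle gives 15 + 6 = 18 + 3 with no slack.\<close>
      have "card D = card (\<Union>D)" using cyc_card_Union[OF D(2)] by simp
      also have "\<dots> \<le> card V" using fin edges D(1) by (intro card_mono) auto
      finally have DV: "card D \<le> card V" .
      show ?thesis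
      proof (cases "6 \<le> card D")
        case True
        then show ?thesis using DV unfolding \<open>E = D\<close> by linarith
      next
        case False
        then have "card D = 3" using len D(1,2) by blast
        then have "D \<in> triangles E" using D by (simp add: triangles_def)
        then have "1 \<le> card (triangles E)"
          using finite_triangles[OF fin(2)] by (metis One_nat_def Suc_leI card_gt_0_iff empty_iff)
        then show ?thesis using DV \<open>card D = 3\<close> unfolding \<open>E = D\<close> by linarith
      qed
    next
      case False
      then obtain e where e: "e \<in> E - D" using D(1) by blast
      have U: "\<Union>D \<subseteq> V" using edges D(1) by blast
      obtain e' where "e' \<in> D" using D cyc_card_Union[of D] by fastforce
      obtain u1 u2 where u: "u1 \<in> \<Union>D" "u2 \<in> \<Union>D" "u1 \<noteq> u2"
        using cyc_edgeD[OF D(2) \<open>e' \<in> D\<close>] \<open>e' \<in> D\<close> by (metis UnionI insertI1 insert_commute)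
      obtain a b zs where z: "a \<noteq> b" "path_betw a zs b" "path_edges zs \<subseteq> E"
        "set zs \<inter> \<Union>D = {a, b}" "path_edges zs \<inter> D = {}"
        using ear_edge[OF edges nonsep U u subset_refl e] by metis
      then obtain xs ys where th: "theta V E p \<gamma> a b xs ys zs" and Dxy: "D = path_edges xs \<union> path_edges ys"
        using theta_of_ear[OF pl D(2,1)] by metis
      interpret theta V E p \<gamma> a b xs ys zs by (rule th)
      \<comment> \<open>Everything is enclosed by \<open>D\<close>, so an ear on \<open>D\<close>
        runs through its interior and cuts the disc in two.\<close>
      obtain f where f: "f \<in> Z" using path_betw_edges_nonempty[OF z(2,1)] by blast
      have fE: "f \<in> E" "f \<notin> D" using f z by auto
      have "open_edge p \<gamma> f \<subseteq> disc \<gamma> D" using D(3)[OF fE(1)] by (auto simp: open_edge_def)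
      then have "open_edge p \<gamma> f \<subseteq> inside (curve \<gamma> D)"
        using edge_in_disc(2)[OF pl fE(1) D(1) fE(2)] open_edge(2)[OF pl fE(1)] by blast
      moreover have "open_edge p \<gamma> f \<subseteq> curve \<gamma> Z" using f by (auto simp: open_edge_def curve_def)
      ultimately have "curve \<gamma> Z \<inter> inside (curve \<gamma> (X \<union> Y)) \<noteq> {}"
        using open_edge(2)[OF pl fE(1)] Dxy by blast
      then show ?thesis unfolding Dxy
      proof (rule disc_bound[rotated 2])
        fix V' E' D'
        assume *: "plane V' E' p \<gamma>" "V' \<noteq> {}" "V' \<subseteq> V" "E' \<subset> E" "D' \<subseteq> E'" "cyc D'"
          "\<And>e. e \<in> E' \<Longrightarrow> path_image (\<gamma> e) \<subseteq> disc \<gamma> D'" "\<And>v. v \<in> V' \<Longrightarrow> p v \<in> disc \<gamma> D'"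
        have "card V' + card E' < card V + card E"
          using card_mono[OF fin(1) *(3)] psubset_card_mono[OF fin(2) *(4)] by simp
        moreover have "\<forall>D. D \<subseteq> E' \<longrightarrow> cyc D \<longrightarrow> card D = 3 \<or> 6 \<le> card D"
          using len *(4) by blast
        ultimately show "4 * card E' + card D' + 6 \<le> 6 * card V' + 3 * card (triangles E')"
          using less.hyps[of V' E'] *(1,2,5-8) by blast
      qed (use D Dxy in auto)
    qed
    have "4 * card E + 6 \<le> 6 * card V + 3 * card (triangles E)"
    proof (cases "E = {}")
      case True
      have "1 \<le> card V" using fin less.prems(2) by (simp add: Suc_leI card_gt_0_iff)
      then show ?thesis using True by simp
    next
      case False
      then obtain e where e: "e \<in> E" by blast
      obtain u v where uv: "e = {u, v}" "u \<noteq> v" using edges[OF e] by (metis card_2_iff)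
      show ?thesis
      proof (cases "V = e")
        case True
        have "f = e" if "f \<in> E" for f
          using edges[OF that] edges[OF e] True fin by (metis card_subset_eq)
        then have "E = {e}" using e by blast
        then show ?thesis using True edges[OF e] by simp
      next
        case False
        then obtain d where d: "d \<in> V - e" using edges[OF e] by blast
        \<comment> \<open>An ear on the two ends of \<open>e\<close> closes up with \<open>e\<close>
          to a cycle, as needed to start the enclosure argument.\<close>
        obtain a b zs where z: "a \<noteq> b" "path_betw a zs b" "path_edges zs \<subseteq> E"
          "set zs \<inter> e = {a, b}" "\<And>f. f \<in> path_edges zs \<Longrightarrow> \<not> f \<subseteq> e"
          using ear_vertex[OF edges nonsep _ _ _ uv(2) d] edges[OF e] uv(1) by (metis insertI1 insert_commute)
        have "{a, b} \<subseteq> {u, v}" unfolding z(4)[symmetric] uv(1) by (rule Int_lower2)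
        then have "e = {a, b}" using z(1) uv(1) by auto
        then have "zs \<noteq> [a, b]" using z(5) by auto
        then have "cyc (path_edges zs \<union> path_edges [a, b])"
          using cyc_join[OF z(2) _ z(1), of "[a, b]"] z \<open>e = {a, b}\<close> by (auto simp: path_betw_def)
        moreover have "path_edges zs \<union> path_edges [a, b] \<subseteq> E" using z(3) e \<open>e = {a, b}\<close> by simp
        ultimately obtain D where "cyc D" "D \<subseteq> E" "\<And>e. e \<in> E \<Longrightarrow> path_image (\<gamma> e) \<subseteq> disc \<gamma> D"
          "\<And>v. v \<in> V \<Longrightarrow> p v \<in> disc \<gamma> D"
          using nonseparable_enclosed[OF pl nonsep] by metis
        then show ?thesis using disc[of D] by simp
      qed
    qed
    then show ?thesis using disc by blast
  qed
qed

section \<open>Discharging\<close>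

text \<open>
  Charges are in quarter units: a vertex of degree \<open>x\<close> has \<open>8x - 24\<close>, and every edge of a triangle
  costs 2 at either end. So \<open>x\<close> can spend \<open>8 - 24/x\<close> per edge, or \<open>12 - 48/x\<close> per triangle after the
  cost of the triangle; the constants are roundings of these at the thresholds. \<open>gift_plain x w\<close> is
  sent to a neighbour of degree \<open>w \<le> 3\<close> along an edge in no triangle, \<open>gift_tri x y\<close> along an edge of a
  triangle whose third corner has degree \<open>y\<close> (and also needs help if \<open>y \<le> 3\<close>).
\<close>

definition gift_plain :: "int \<Rightarrow> int \<Rightarrow> int" where
  "gift_plain x w = (if 24 \<le> x then 7 else if 12 \<le> x then 6 else if 4 \<le> x then 2
     else if x = 3 \<and> w = 2 then 1 else 0)"

definition gift_tri :: "int \<Rightarrow> int \<Rightarrow> int" where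
  "gift_tri x y = (if y \<le> 3 then (if 24 \<le> x then 5 else if 12 \<le> x then 4 else if 5 \<le> x then 1 else 0)
     else (if 24 \<le> x then 10 else if 12 \<le> x then 8 else if 5 \<le> x then 2 else 0))"

text \<open>One neighbour accounts for at most \<open>M\<close>, so \<open>k\<close> is at least 3.
  For \<open>k = 3\<close> the neighbour has degree \<open>M\<close>, and its 7 units cover the
  deficit, which is at most 16 - 12 + 2 = 6.\<close>

lemma gift_deg1:
  assumes "32 \<le> M" "x \<le> M" "M + 3 \<le> x + k" "s \<le> 1"
  shows "0 \<le> - 16 + 4 * k - 2 * s + gift_plain x 1"
  using assms unfolding gift_plain_def by (auto split: if_split)

text \<open>The critical case is \<open>k = 0\<close>. A neighbour of degree at least 24 sends 7 and
  the other, of degree at least 3, sends at least 1. Without such a neighbour both have degree at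
  least 12 and send 6 each.\<close>

lemma gift_deg2:
  assumes "32 \<le> M" "x \<le> M" "y \<le> M" "M + 3 \<le> x + y + k" "0 \<le> s" "s \<le> 2" "s \<le> k"
  shows "0 \<le> - 8 + 4 * k - 2 * s + (gift_plain x 2 + gift_plain y 2)"
  using assms unfolding gift_plain_def by (auto split: if_split)

text \<open>For \<open>k = 0\<close> both degrees are at least 5: one of at least 24 gives 10 and
  the other at least 2, otherwise both are at least 14 and give 8 each.\<close>

lemma gift_deg2_tri:
  assumes "32 \<le> M" "x \<le> M" "y \<le> M" "M + 5 \<le> x + y + k" "0 \<le> k"
  shows "0 \<le> - 12 + 4 * k + (gift_tri x y + gift_tri y x)"
  using assms unfolding gift_tri_def by (auto split: if_split)

text \<open>The left side is what is passed on to neighbours of degree 2. For \<open>k = 0\<close>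
  some neighbour has degree at least 12 and sends at least 6. For \<open>k > 0\<close> the vertex
  has at least 2 units of its own, and three neighbours of degree 2 would make \<open>k\<close> very
  large.\<close>

lemma gift_deg3:
  assumes "32 \<le> M" "x \<le> M" "y \<le> M" "z \<le> M" "M + 3 \<le> x + y + z + k" "0 \<le> s" "s \<le> 3" "s \<le> k"
  shows "(if x = 2 then 1 else 0) + (if y = 2 then 1 else 0) + (if z = 2 then 1 else 0)
    \<le> 4 * k - 2 * s + (gift_plain x 3 + gift_plain y 3 + gift_plain z 3)"
  using assms unfolding gift_plain_def by (auto split: if_split)

text \<open>The extreme case is \<open>x = M\<close>, \<open>y = 3\<close>, \<open>z = 2\<close>,
  \<open>k = 0\<close>: the 5 units from \<open>x\<close> cover the 4 for the triangle and the 1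
  passed on to \<open>z\<close>.\<close>

lemma gift_deg3_tri:
  assumes "32 \<le> M" "x \<le> M" "y \<le> M" "z \<le> M" "M + 5 \<le> x + y + z + k" "0 \<le> s" "s \<le> 1" "s \<le> k"
  shows "(if z = 2 then 1 else 0)
    \<le> - 4 + 4 * k - 2 * s + (gift_tri x y + gift_tri y x + gift_plain z 3)"
  using assms unfolding gift_plain_def gift_tri_def by (auto split: if_split)

text \<open>
  \<open>S\<close> stands for a maximal set of peeled vertices. Degrees are then counted outside \<open>S\<close> (\<open>d\<close> below),
  \<open>t\<close> is twice the number of triangles at a vertex outside \<open>S\<close>, \<open>s\<close> the number of triangles with a
  corner in \<open>S\<close>, and \<open>k\<close> bounds the vertices outside \<open>S\<close> reached only through \<open>S\<close>.
\<close>

locale peeled_graph =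
  fixes V S :: "'a set" and N :: "'a \<Rightarrow> 'a set" and M :: nat
  assumes finite_V: "finite V" and N_subset: "\<And>v. v \<in> V \<Longrightarrow> N v \<subseteq> V"
    and N_sym: "\<And>u v. u \<in> N v \<Longrightarrow> v \<in> N u" and N_irrefl: "\<And>v. v \<notin> N v"
    and one_triangle: "\<And>u v. v \<in> V \<Longrightarrow> u \<in> N v \<Longrightarrow> card (N u \<inter> N v) \<le> 1"
    and degree: "\<And>v. v \<in> V \<Longrightarrow> card (N v) \<le> M" and M: "32 \<le> M"
    and S_subset: "S \<subseteq> V" and S_indep: "\<And>u. u \<in> S \<Longrightarrow> N u \<inter> S = {}"
    and S_degree: "\<And>u. u \<in> S \<Longrightarrow> card (N u) = 2 \<and> (\<forall>w\<in>N u. N u \<inter> N w = {}) \<or> card (N u) = 3"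
    and not_peelable: "\<And>w. w \<in> V - S \<Longrightarrow> card (N w - S) \<le> 3 \<Longrightarrow>
      M + 3 \<le> card ({u. u \<noteq> w \<and> (u \<in> N w \<or> N u \<inter> N w \<noteq> {})} - S)"
begin

section \<open>Counts around a vertex outside \<open>S\<close>\<close>

definition A where "A w = N w - S"
definition B where "B w = N w \<inter> S"
definition d where "d w = int (card (A w))"
definition h where "h w x = int (card (N x \<inter> A w))"
definition t where "t w = (\<Sum>x\<in>A w. h w x)"
definition s where "s w = (\<Sum>u\<in>B w. h w u)"
definition k where "k w = (\<Sum>u\<in>B w. int (card (N u)) - 1 - h w u)"
definition \<tau> where "\<tau> v = (\<Sum>x\<in>N v. int (card (N x \<inter> N v)))"

lemma finite_N: "v \<in> V \<Longrightarrow> finite (N v)"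
  using N_subset finite_V finite_subset by blast

lemma finite_AB: "v \<in> V \<Longrightarrow> finite (A v) \<and> finite (B v)"
  using finite_N by (auto simp: A_def B_def)

lemma A_in: "w \<in> V \<Longrightarrow> x \<in> A w \<Longrightarrow> x \<in> V - S \<and> x \<in> N w"
  using N_subset by (auto simp: A_def)

lemma B_in: "x \<in> B w \<Longrightarrow> x \<in> S \<and> x \<in> N w \<and> x \<in> V"
  using S_subset by (auto simp: B_def)

lemma A_sym: "w \<in> V - S \<Longrightarrow> x \<in> A w \<Longrightarrow> w \<in> A x"
  using N_sym by (auto simp: A_def)

lemma B_eq: "u \<in> B w \<Longrightarrow> N u \<inter> A w = N u \<inter> N w"
  using S_indep by (auto simp: A_def B_def)

lemma h_le1: "w \<in> V \<Longrightarrow> x \<in> N w \<Longrightarrow> h w x \<le> 1"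
proof -
  assume "w \<in> V" "x \<in> N w"
  then have "card (N x \<inter> A w) \<le> card (N x \<inter> N w)"
    using finite_N by (intro card_mono) (auto simp: A_def)
  then show ?thesis using one_triangle[OF \<open>w \<in> V\<close> \<open>x \<in> N w\<close>] by (simp add: h_def)
qed

lemma h_nonneg: "0 \<le> h w x"
  by (simp add: h_def)

lemma h_sym: "h w x = h x w" if "w \<in> V - S" "x \<in> A w"
  using that by (auto simp: h_def A_def intro!: arg_cong[where f=card])

lemma card_Int_swap:
  assumes "finite X" "finite Y"
  shows "(\<Sum>x\<in>X. int (card (N x \<inter> Y))) = (\<Sum>y\<in>Y. int (card (N y \<inter> X)))"
proof -
  have eq: "int (card (N x \<inter> Y)) = (\<Sum>y\<in>Y. if y \<in> N x then 1 else 0)" if "finite Y" for x Y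
    using that by (simp add: sum.If_cases Int_commute Int_def conj_commute)
  have "(\<Sum>x\<in>X. int (card (N x \<inter> Y))) = (\<Sum>x\<in>X. \<Sum>y\<in>Y. if y \<in> N x then 1 else 0)"
    using eq[OF assms(2)] by simp
  also have "\<dots> = (\<Sum>y\<in>Y. \<Sum>x\<in>X. if x \<in> N y then 1 else 0)"
    by (subst sum.swap) (intro sum.cong refl if_cong; use N_sym in blast)
  also have "\<dots> = (\<Sum>y\<in>Y. int (card (N y \<inter> X)))"
    using eq[OF assms(1)] by simp
  finally show ?thesis .
qed

lemma s_alt: "w \<in> V \<Longrightarrow> s w = (\<Sum>x\<in>A w. int (card (N x \<inter> B w)))"
  unfolding s_def h_def using card_Int_swap finite_AB by blast

lemma card_split:
  assumes "w \<in> V" "x \<in> N w"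
  shows "int (card (N x \<inter> N w)) = h w x + int (card (N x \<inter> B w))"
proof -
  have "card (N x \<inter> N w) = card ((N x \<inter> A w) \<union> (N x \<inter> B w))"
    by (rule arg_cong[where f=card]) (auto simp: A_def B_def)
  also have "\<dots> = card (N x \<inter> A w) + card (N x \<inter> B w)"
    using finite_AB[OF assms(1)] by (intro card_Un_disjoint) (auto simp: A_def B_def)
  finally show ?thesis by (simp add: h_def)
qed

lemma N_split: "N w = A w \<union> B w" "A w \<inter> B w = {}"
  by (auto simp: A_def B_def)

text \<open>A triangle at \<open>w\<close> with a corner in \<open>S\<close> has only that corner in
  \<open>S\<close>. It is counted from both of its corners other than \<open>w\<close>, once through
  each.\<close>

lemma \<tau>_eq: "w \<in> V \<Longrightarrow> \<tau> w = t w + 2 * s w"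
proof -
  assume w: "w \<in> V"
  have "\<tau> w = (\<Sum>x\<in>A w. int (card (N x \<inter> N w))) + (\<Sum>x\<in>B w. int (card (N x \<inter> N w)))"
    unfolding \<tau>_def using finite_AB[OF w] N_split(2) by (subst N_split(1)) (rule sum.union_disjoint; simp)
  also have "(\<Sum>x\<in>B w. int (card (N x \<inter> N w))) = s w"
    unfolding s_def h_def by (intro sum.cong refl) (simp add: B_eq)
  also have "(\<Sum>x\<in>A w. int (card (N x \<inter> N w))) = t w + s w"
    unfolding t_def s_alt[OF w] sum.distrib[symmetric]
    by (intro sum.cong refl card_split w) (simp add: A_def)
  finally show ?thesis by simp
qed

text \<open>A neighbour outside \<open>S\<close> shares at most one neighbour with \<open>w\<close>,
  which is counted in \<open>t w\<close> if it lies outside \<open>S\<close> and in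
  \<open>s w\<close> otherwise.\<close>

lemma s_le: "w \<in> V \<Longrightarrow> s w \<le> d w - t w"
proof -
  assume w: "w \<in> V"
  have "t w + s w = (\<Sum>x\<in>A w. int (card (N x \<inter> N w)))"
    unfolding t_def s_alt[OF w] sum.distrib[symmetric]
    by (intro sum.cong refl card_split[symmetric] w) (simp add: A_def)
  also have "\<dots> \<le> (\<Sum>x\<in>A w. 1)"
    by (intro sum_mono) (use one_triangle[OF w] in \<open>auto simp: A_def\<close>)
  finally show ?thesis by (simp add: d_def)
qed

lemma s_nonneg: "0 \<le> s w"
  unfolding s_def by (intro sum_nonneg h_nonneg)

lemma B_degree: "u \<in> B w \<Longrightarrow> card (N u) = 2 \<and> h w u = 0 \<or> card (N u) = 3"
proof -
  assume u: "u \<in> B w"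
  then have "card (N u) = 2 \<and> (\<forall>w\<in>N u. N u \<inter> N w = {}) \<or> card (N u) = 3"
    using S_degree by (auto simp: B_def)
  moreover have "w \<in> N u" using u N_sym by (auto simp: B_def)
  ultimately show ?thesis using B_eq[OF u] by (auto simp: h_def)
qed

text \<open>A vertex of \<open>S\<close> of degree 2 lies in no triangle, and one of degree 3 that
  forms a triangle with \<open>w\<close> still leads to one further vertex.\<close>

lemma s_le_k: "w \<in> V \<Longrightarrow> s w \<le> k w"
proof -
  assume w: "w \<in> V"
  have "h w u \<le> int (card (N u)) - 1 - h w u" if "u \<in> B w" for u
    using B_degree[OF that] h_le1[OF w, of u] that by (auto simp: B_def)
  then show ?thesis unfolding s_def k_def by (rule sum_mono)
qed

lemma d_le: "x \<in> V \<Longrightarrow> d x \<le> int M"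
proof -
  assume x: "x \<in> V"
  have "card (A x) \<le> card (N x)" using finite_N[OF x] by (intro card_mono) (auto simp: A_def)
  then show ?thesis using degree[OF x] by (simp add: d_def)
qed

text \<open>Through \<open>x\<close> outside \<open>S\<close> one sees its \<open>d x\<close>
  neighbours outside \<open>S\<close>, with \<open>x\<close> itself in the place of
  \<open>w\<close>, less the \<open>h w x\<close> that are neighbours of \<open>w\<close> and count
  for themselves; these losses sum to \<open>t w\<close>. A vertex of \<open>S\<close> shows its
  other neighbours but not itself.\<close>

lemma second_neighbours:
  assumes w: "w \<in> V - S" and "d w \<le> 3"
  shows "int M + 3 \<le> (\<Sum>x\<in>A w. d x) - t w + k w"
proof -
  have wV: "w \<in> V" using w by simp
  let ?R = "\<Union>x\<in>A w. insert x (N x - S - {w} - A w)"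
  let ?Q = "\<Union>u\<in>B w. N u - {w} - A w"
  have "{u. u \<noteq> w \<and> (u \<in> N w \<or> N u \<inter> N w \<noteq> {})} - S \<subseteq> ?R \<union> ?Q"
  proof
    fix u assume u: "u \<in> {u. u \<noteq> w \<and> (u \<in> N w \<or> N u \<inter> N w \<noteq> {})} - S"
    show "u \<in> ?R \<union> ?Q"
    proof (cases "u \<in> A w")
      case True
      then show ?thesis by auto
    next
      case False
      then obtain x where "x \<in> N u" "x \<in> N w" using u by (auto simp: A_def)
      then have "u \<in> N x" using N_sym by blast
      then show ?thesis using u False \<open>x \<in> N w\<close> by (auto simp: A_def B_def)
    qed
  qed
  moreover have fin: "finite (N x)" if "x \<in> A w \<or> x \<in> B w" for x
    using that A_in[OF wV] B_in finite_N by blast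
  then have finRQ: "finite ?R" "finite ?Q" using finite_AB[OF wV] by auto
  ultimately have "card ({u. u \<noteq> w \<and> (u \<in> N w \<or> N u \<inter> N w \<noteq> {})} - S) \<le> card (?R \<union> ?Q)"
    by (intro card_mono) auto
  also have "\<dots> \<le> card ?R + card ?Q" by (rule card_Un_le)
  also have "\<dots> \<le> (\<Sum>x\<in>A w. card (insert x (N x - S - {w} - A w))) + (\<Sum>u\<in>B w. card (N u - {w} - A w))"
    using finite_AB[OF wV] by (intro add_mono card_UN_le) auto
  finally have "M + 3 \<le> (\<Sum>x\<in>A w. card (insert x (N x - S - {w} - A w))) + (\<Sum>u\<in>B w. card (N u - {w} - A w))"
    using not_peelable[OF w] assms(2) by (simp add: d_def A_def)
  then have "int M + 3 \<le> (\<Sum>x\<in>A w. int (card (insert x (N x - S - {w} - A w)))) + (\<Sum>u\<in>B w. int (card (N u - {w} - A w)))"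
    by (simp flip: of_nat_sum of_nat_add)
  also have "(\<Sum>x\<in>A w. int (card (insert x (N x - S - {w} - A w)))) \<le> (\<Sum>x\<in>A w. d x - h w x)"
  proof (rule sum_mono)
    fix x assume x: "x \<in> A w"
    have wx: "w \<in> A x" using A_sym[OF w x] .
    have f: "finite (N x)" using fin x by blast
    have "card (insert x (N x - S - {w} - A w)) \<le> Suc (card (N x - S - {w} - A w))"
      by (rule card_insert_le_m1) auto
    moreover have "card (A x) = card (insert w ((N x - S - {w} - A w) \<union> (N x \<inter> A w)))"
      by (rule arg_cong[where f=card]) (use wx in \<open>auto simp: A_def\<close>)
    moreover have "\<dots> = Suc (card ((N x - S - {w} - A w) \<union> (N x \<inter> A w)))"
      using f N_irrefl[of w] by (intro card_insert_disjoint) (auto simp: A_def)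
    moreover have "card ((N x - S - {w} - A w) \<union> (N x \<inter> A w)) = card (N x - S - {w} - A w) + card (N x \<inter> A w)"
      using f by (intro card_Un_disjoint) auto
    ultimately show "int (card (insert x (N x - S - {w} - A w))) \<le> d x - h w x"
      by (simp add: d_def h_def)
  qed
  also have "(\<Sum>u\<in>B w. int (card (N u - {w} - A w))) \<le> k w"
    unfolding k_def
  proof (rule sum_mono)
    fix u assume u: "u \<in> B w"
    have f: "finite (N u)" using fin u by blast
    have wu: "w \<in> N u" using u N_sym by (auto simp: B_def)
    have "card (N u) = card (insert w ((N u - {w} - A w) \<union> (N u \<inter> A w)))"
      by (rule arg_cong[where f=card]) (use wu in \<open>auto simp: A_def\<close>)
    also have "\<dots> = Suc (card ((N u - {w} - A w) \<union> (N u \<inter> A w)))"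
      using f N_irrefl[of w] by (intro card_insert_disjoint) (auto simp: A_def)
    also have "card ((N u - {w} - A w) \<union> (N u \<inter> A w)) = card (N u - {w} - A w) + card (N u \<inter> A w)"
      using f by (intro card_Un_disjoint) auto
    finally show "int (card (N u - {w} - A w)) \<le> int (card (N u)) - 1 - h w u"
      by (simp add: h_def)
  qed
  finally show ?thesis by (simp add: t_def sum_subtractf)
qed

section \<open>Transfers between vertices outside \<open>S\<close>\<close>

definition third where "third w x = (SOME y. y \<in> N x \<inter> N w - S)"

definition flow where
  "flow x w = (if 4 \<le> d w then 0 else if h w x = 0 then gift_plain (d x) (d w)
     else gift_tri (d x) (d (third w x)))"

text \<open>The initial charge less the payments to \<open>S\<close>, as \<open>charge_eq\<close>
  confirms: a neighbour in \<open>S\<close> contributes 4 for each new vertex seen through it and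
  loses 2 if it forms a triangle with \<open>w\<close> and a vertex outside
  \<open>S\<close>.\<close>

definition charge where "charge w = 8 * d w - 24 - 2 * t w + 4 * k w - 2 * s w"

text \<open>The choice is made from \<open>N x \<inter> N w - S\<close> rather than from the equal
  set \<open>N x \<inter> A w\<close>, so that the symmetry is plain commutativity.\<close>

lemma third_sym: "third w x = third x w"
  by (simp add: third_def Int_commute)

lemma third:
  assumes "w \<in> V - S" "x \<in> A w" "h w x \<noteq> 0"
  shows "N x \<inter> A w = {third w x}" "h w x = 1"
proof -
  have "h w x \<le> 1" using h_le1 assms by (auto simp: A_def)
  then show 1: "h w x = 1" using h_nonneg[of w x] assms(3) by linarith
  then obtain y where y: "N x \<inter> A w = {y}" by (auto simp: h_def card_1_singleton_iff)
  have "N x \<inter> N w - S = N x \<inter> A w" by (auto simp: A_def)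
  then show "N x \<inter> A w = {third w x}" using y by (simp add: third_def)
qed

lemma third_third:
  assumes "w \<in> V - S" "x \<in> A w" "h w x \<noteq> 0"
  shows "third w x \<in> A w" "h w (third w x) \<noteq> 0" "third w (third w x) = x"
proof -
  let ?y = "third w x"
  have y: "?y \<in> N x" "?y \<in> A w" using third(1)[OF assms] by auto
  then show "?y \<in> A w" by simp
  have x: "x \<in> N ?y \<inter> A w" using y N_sym assms(2) by auto
  have "finite (A w)" using finite_AB assms(1) by blast
  then show "h w ?y \<noteq> 0" using x by (auto simp: h_def)
  then have "N ?y \<inter> A w = {third w ?y}" using third(1) y(2) assms(1) by blast
  then show "third w ?y = x" using x by auto
qed

lemma flow_nonneg: "0 \<le> flow x w"
  by (auto simp: flow_def gift_plain_def gift_tri_def)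

text \<open>Every edge at \<open>w\<close> has the allowance \<open>c\<close>, of which an edge in a
  triangle cedes 2. A single gift may exceed \<open>c - 2\<close>, but then the other edge of the
  triangle gets nothing; so the two are balanced as a pair.\<close>

lemma high_charge:
  assumes w: "w \<in> V - S" and "4 \<le> d w"
  shows "(\<Sum>x\<in>A w. flow w x) \<le> charge w + (\<Sum>x\<in>A w. flow x w)"
proof -
  \<comment> \<open>The values of \<open>8 - 24 / x\<close> at 4, 5, 12 and 24, rounded down; hence
    \<open>d w * c \<le> 8 * d w - 24\<close>.\<close>
  define c :: int where "c = (if 24 \<le> d w then 7 else if 12 \<le> d w then 6 else if 5 \<le> d w then 3 else 2)"
  let ?T = "{x \<in> A w. h w x \<noteq> 0}"
  have fin: "finite (A w)" using finite_AB w by blast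
  have fl: "flow w x = (if 4 \<le> d x then 0 else if h w x = 0 then gift_plain (d w) (d x)
     else gift_tri (d w) (d (third w x)))" if "x \<in> A w" for x
    unfolding flow_def third_sym[of x w] h_sym[OF w that, symmetric] ..
  have plain: "flow w x \<le> c" if "x \<in> A w - ?T" for x
    using that assms(2) fl[of x] by (auto simp: c_def gift_plain_def)
  have pair: "flow w x + flow w (third w x) \<le> 2 * (c - 2)" if "x \<in> ?T" for x
  proof -
    have x: "x \<in> A w" "h w x \<noteq> 0" using that by auto
    note y = third_third[OF w x]
    show ?thesis
      using assms(2) fl[OF x(1)] fl[OF y(1)] x y by (auto simp: c_def gift_tri_def)
  qed
  \<comment> \<open>\<open>third w\<close> swaps the two ends of each triangle edge opposite
    \<open>w\<close>, so twice the sum is the sum over pairs.\<close>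
  have "bij_betw (third w) ?T ?T"
    by (rule bij_betw_byWitness[where f' = "third w"]) (use third_third[OF w] in auto)
  then have "(\<Sum>x\<in>?T. flow w x) = (\<Sum>x\<in>?T. flow w (third w x))"
    by (rule sum.reindex_bij_betw[symmetric])
  then have "2 * (\<Sum>x\<in>?T. flow w x) = (\<Sum>x\<in>?T. flow w x + flow w (third w x))"
    by (simp add: sum.distrib)
  also have "\<dots> \<le> (\<Sum>x\<in>?T. 2 * (c - 2))" using pair by (rule sum_mono)
  finally have "2 * (\<Sum>x\<in>?T. flow w x) \<le> 2 * (int (card ?T) * (c - 2))" by (simp add: algebra_simps)
  then have T: "(\<Sum>x\<in>?T. flow w x) \<le> int (card ?T) * (c - 2)" by simp
  have "(\<Sum>x\<in>A w. flow w x) = (\<Sum>x\<in>A w - ?T. flow w x) + (\<Sum>x\<in>?T. flow w x)"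
    using fin by (intro sum.subset_diff) auto
  also have "(\<Sum>x\<in>A w - ?T. flow w x) \<le> int (card (A w - ?T)) * c"
    using sum_mono[of "A w - ?T" "flow w" "\<lambda>_. c"] plain by simp
  also have "int (card (A w - ?T)) = d w - int (card ?T)"
  proof -
    have "card (A w - ?T) = card (A w) - card ?T" "card ?T \<le> card (A w)"
      using fin by (auto intro!: card_Diff_subset card_mono)
    then show ?thesis by (simp add: d_def)
  qed
  finally have "(\<Sum>x\<in>A w. flow w x) \<le> (d w - int (card ?T)) * c + int (card ?T) * (c - 2)"
    using T by linarith
  also have "\<dots> = d w * c - 2 * int (card ?T)" by (simp add: algebra_simps)
  also have "int (card ?T) = t w"
  proof -
    have "t w = (\<Sum>x\<in>?T. h w x)" unfolding t_def using fin by (intro sum.mono_neutral_right) auto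
    also have "\<dots> = (\<Sum>x\<in>?T. 1)" using third(2)[OF w] by (intro sum.cong) auto
    finally show ?thesis by simp
  qed
  also have "d w * c \<le> 8 * d w - 24" using assms(2) by (auto simp: c_def)
  finally have "(\<Sum>x\<in>A w. flow w x) \<le> 8 * d w - 24 - 2 * t w" by simp
  moreover have "0 \<le> (\<Sum>x\<in>A w. flow x w)" by (intro sum_nonneg flow_nonneg)
  moreover have "0 \<le> 4 * k w - 2 * s w" using s_le_k[of w] s_nonneg[of w] w by simp
  ultimately show ?thesis unfolding charge_def by linarith
qed

text \<open>The single unit from degree 3 to degree 2 completes the 7 units that a vertex of degree
  2 gets from a neighbour of degree at least 24.\<close>

lemma flow_out_low:
  assumes "w \<in> V - S" "x \<in> A w" "d w \<le> 3"
  shows "flow w x = (if h w x = 0 \<and> d w = 3 \<and> d x = 2 then 1 else 0)"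
  using assms unfolding flow_def third_sym[of x w] h_sym[OF assms(1,2), symmetric]
  by (auto simp: gift_plain_def gift_tri_def)

lemma flow_in_low:
  assumes "d w \<le> 3"
  shows "flow x w = (if h w x = 0 then gift_plain (d x) (d w) else gift_tri (d x) (d (third w x)))"
  using assms by (simp add: flow_def)

lemma adjacent_sym: "y \<in> N x \<longleftrightarrow> x \<in> N y"
  using N_sym by blast

text \<open>The cases are the number of neighbours outside \<open>S\<close> and whether two of these
  are adjacent. With three neighbours at most one pair is, since two pairs would put an edge at
  \<open>w\<close> in two triangles.\<close>

lemma low_charge:
  assumes w: "w \<in> V - S" and low: "d w \<le> 3"
  shows "(\<Sum>x\<in>A w. flow w x) \<le> charge w + (\<Sum>x\<in>A w. flow x w)"
proof -
  have wV: "w \<in> V" using w by simp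
  note K = second_neighbours[OF w low]
  have sk: "0 \<le> s w" "s w \<le> k w" "s w \<le> d w - t w" using s_nonneg s_le_k s_le wV by auto
  have M': "32 \<le> int M" using M by simp
  have dA: "d x \<le> int M" "x \<notin> N x" if "x \<in> A w" for x using d_le A_in[OF wV that] N_irrefl by auto
  have "card (A w) \<le> 3" using low by (simp add: d_def)
  then consider "card (A w) = 0" | "card (A w) = 1" | "card (A w) = 2" | "card (A w) = 3" by linarith
  then show ?thesis
  proof cases
    case 1
    then have "A w = {}" using finite_AB wV by simp
    \<comment> \<open>All of the at least M + 3 vertices are seen through \<open>S\<close>, and
      \<open>4 * k w\<close> far outweighs 24.\<close>
    then show ?thesis using K sk M' by (simp add: charge_def d_def t_def)
  next
    case 2
    then obtain x where A: "A w = {x}" by (auto simp: card_1_singleton_iff)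
    have dw: "d w = 1" using 2 by (simp add: d_def)
    have x: "x \<in> A w" using A by simp
    have h: "h w x = 0" using dA(2)[OF x] by (simp add: h_def A)
    have t: "t w = 0" using h by (simp add: t_def A)
    have "flow w x = 0" using flow_out_low[OF w x low] dw by simp
    moreover have "flow x w = gift_plain (d x) 1" using flow_in_low[OF low, of x] h dw by simp
    ultimately show ?thesis
      using gift_deg1[OF M' dA(1)[OF x], of "k w" "s w"] K sk dw t by (simp add: charge_def A)
  next
    case 3
    then obtain x y where A: "A w = {x, y}" "x \<noteq> y" by (auto simp: card_2_iff)
    have dw: "d w = 2" using 3 by (simp add: d_def)
    have xy: "x \<in> A w" "y \<in> A w" using A by auto
    have out: "flow w x = 0" "flow w y = 0" using flow_out_low[OF w _ low] xy dw by auto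
    show ?thesis
    proof (cases "y \<in> N x")
      case True
      then have hx: "N x \<inter> A w = {y}" "N y \<inter> A w = {x}"
        using dA(2) xy adjacent_sym A by auto
      then have h: "h w x = 1" "h w y = 1" by (auto simp: h_def)
      have th: "third w x = y" "third w y = x"
        using third(1)[OF w xy(1)] third(1)[OF w xy(2)] h hx by auto
      have t: "t w = 2" using h A by (simp add: t_def)
      have "flow x w = gift_tri (d x) (d y)" "flow y w = gift_tri (d y) (d x)"
        using flow_in_low[OF low] h th by simp_all
      then show ?thesis
        using gift_deg2_tri[OF M' dA(1)[OF xy(1)] dA(1)[OF xy(2)], of "k w"] K sk dw t out A
        by (simp add: charge_def)
    next
      case False
      then have h: "h w x = 0" "h w y = 0"
        using dA(2) xy adjacent_sym A by (auto simp: h_def)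
      have t: "t w = 0" using h A by (simp add: t_def)
      have "flow x w = gift_plain (d x) 2" "flow y w = gift_plain (d y) 2"
        using flow_in_low[OF low] h dw by simp_all
      then show ?thesis
        using gift_deg2[OF M' dA(1)[OF xy(1)] dA(1)[OF xy(2)], of "k w" "s w"] K sk dw t out A
        by (simp add: charge_def)
    qed
  next
    case 4
    have dw: "d w = 3" using 4 by (simp add: d_def)
    show ?thesis
    proof (cases "\<exists>x\<in>A w. \<exists>y\<in>A w. y \<in> N x")
      case True
      then obtain x y where xy: "x \<in> A w" "y \<in> A w" "y \<in> N x" by blast
      then have "x \<noteq> y" using dA(2) by blast
      have "card (A w - {x, y}) = 1" using 4 xy \<open>x \<noteq> y\<close> by (simp add: card_Diff_subset)
      then obtain z where "A w - {x, y} = {z}" by (auto simp: card_1_singleton_iff)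
      then have A: "A w = {x, y, z}" "z \<noteq> x" "z \<noteq> y" using xy by auto
      have z: "z \<in> A w" using A by simp
      have one: "h w v \<le> 1" if "v \<in> A w" for v using h_le1 that wV by (auto simp: A_def)
      have "h w x \<noteq> 0" "h w y \<noteq> 0"
        using xy adjacent_sym finite_AB[OF wV] by (auto simp: h_def)
      then have hx: "N x \<inter> A w = {third w x}" "N y \<inter> A w = {third w y}" "h w x = 1" "h w y = 1"
        using third[OF w] xy by auto
      have "y \<in> N x \<inter> A w" "x \<in> N y \<inter> A w" using xy adjacent_sym by auto
      then have th: "third w x = y" "third w y = x" unfolding hx by simp_all
      \<comment> \<open>\<open>x\<close> and \<open>y\<close> have each other as their only common
        neighbour with \<open>w\<close> in \<open>A w\<close>, which leaves none for
        \<open>z\<close>.\<close>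
      have "z \<notin> N x \<inter> A w" "z \<notin> N y \<inter> A w" unfolding hx th using A by auto
      then have "z \<notin> N x" "z \<notin> N y" using z by auto
      then have "x \<notin> N z" "y \<notin> N z" "z \<notin> N z" using adjacent_sym dA(2)[OF z] by blast+
      then have "N z \<inter> A w = {}" using A by auto
      then have hz: "h w z = 0" by (simp add: h_def)
      have t: "t w = 2" using hx hz A \<open>x \<noteq> y\<close> by (simp add: t_def)
      have "flow x w = gift_tri (d x) (d y)" "flow y w = gift_tri (d y) (d x)" "flow z w = gift_plain (d z) 3"
        using flow_in_low[OF low] hx hz th dw by simp_all
      moreover have "flow w x = 0" "flow w y = 0" "flow w z = (if d z = 2 then 1 else 0)"
        using flow_out_low[OF w _ low] xy z hx hz dw by simp_all
      moreover have "int M + 5 \<le> d x + d y + d z + k w"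
        using K t A \<open>x \<noteq> y\<close> by simp
      moreover have "s w \<le> 1" using sk dw t by simp
      ultimately show ?thesis
        using gift_deg3_tri[OF M' dA(1)[OF xy(1)] dA(1)[OF xy(2)] dA(1)[OF z], of "k w" "s w"]
          sk(1,2) dw t A \<open>x \<noteq> y\<close>
        by (simp add: charge_def)
    next
      case False
      then have h: "h w x = 0" if "x \<in> A w" for x
      proof -
        have "N x \<inter> A w = {}" using False that by blast
        then show ?thesis by (simp add: h_def)
      qed
      obtain x y z where A: "A w = {x, y, z}" "x \<noteq> y" "y \<noteq> z" "x \<noteq> z"
        using 4 by (auto simp: card_3_iff)
      have xyz: "x \<in> A w" "y \<in> A w" "z \<in> A w" using A by auto
      have t: "t w = 0" using h by (simp add: t_def)
      have "flow v w = gift_plain (d v) 3" "flow w v = (if d v = 2 then 1 else 0)" if "v \<in> A w" for v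
        using flow_in_low[OF low] flow_out_low[OF w that low] h[OF that] dw by simp_all
      note fl = this[OF xyz(1)] this[OF xyz(2)] this[OF xyz(3)]
      have "int M + 3 \<le> d x + d y + d z + k w" using K t A by simp
      moreover have "s w \<le> 3" using sk dw t by simp
      ultimately show ?thesis
        using gift_deg3[OF M' dA(1)[OF xyz(1)] dA(1)[OF xyz(2)] dA(1)[OF xyz(3)], of "k w" "s w"]
          sk(1,2) dw t A fl
        by (simp add: charge_def)
    qed
  qed
qed

text \<open>A vertex of \<open>S\<close> has charge -8 if its degree is 2, as it then lies in no
  triangle, and \<open>- 2 * \<tau> u\<close> if its degree is 3. The first deficit is halved
  between the neighbours, the second charged to the corners of the triangles.\<close>

definition pay where "pay w u = (if card (N u) = 2 then 4 else 2 * h w u)"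

lemma S_charge:
  assumes "u \<in> S"
  shows "8 * int (card (N u)) - 24 - 2 * \<tau> u = - (\<Sum>w\<in>N u. pay w u)"
proof (cases "card (N u) = 2")
  case True
  then have "\<forall>w\<in>N u. N u \<inter> N w = {}" using S_degree[OF assms] by auto
  then have "\<tau> u = 0" by (auto simp: \<tau>_def Int_commute)
  then show ?thesis using True by (simp add: pay_def)
next
  case False
  then have 3: "card (N u) = 3" using S_degree[OF assms] by auto
  have "h w u = int (card (N w \<inter> N u))" if "w \<in> N u" for w
  proof -
    have "u \<in> B w" using that assms N_sym by (auto simp: B_def)
    then show ?thesis by (simp add: h_def B_eq Int_commute)
  qed
  then have "2 * \<tau> u = (\<Sum>w\<in>N u. pay w u)"
    using 3 by (simp add: \<tau>_def pay_def sum_distrib_left)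
  then show ?thesis using 3 by simp
qed

lemma charge_eq:
  assumes "w \<in> V"
  shows "charge w = 8 * int (card (N w)) - 24 - 2 * \<tau> w - (\<Sum>u\<in>B w. pay w u)"
proof -
  have fin: "finite (A w)" "finite (B w)" using finite_AB[OF assms] by auto
  have "card (N w) = card (A w) + card (B w)"
    using card_Un_disjoint[OF fin N_split(2)] by (simp flip: N_split(1))
  then have "int (card (N w)) = d w + (\<Sum>u\<in>B w. 1)" by (simp add: d_def)
  moreover have "4 * k w - 2 * s w = (\<Sum>u\<in>B w. 8 - 4 * h w u - pay w u)"
    unfolding k_def s_def sum_distrib_left sum_subtractf[symmetric]
    by (intro sum.cong refl) (use B_degree in \<open>force simp: pay_def\<close>)
  moreover have "(\<Sum>u\<in>B w. 8 - 4 * h w u - pay w u) = 8 * (\<Sum>u\<in>B w. 1) - 4 * s w - (\<Sum>u\<in>B w. pay w u)"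
    by (simp add: sum_subtractf s_def sum_distrib_left)
  ultimately show ?thesis using \<tau>_eq[OF assms] unfolding charge_def by simp
qed

text \<open>Transfers outside \<open>S\<close> cancel in the sum, and \<open>S\<close> is brought to
  zero by its neighbours, which by independence all lie outside \<open>S\<close>.\<close>

theorem total_charge_nonneg: "0 \<le> (\<Sum>v\<in>V. 8 * int (card (N v)) - 24 - 2 * \<tau> v)"
proof -
  let ?H = "V - S"
  have finH: "finite ?H" "finite S" using finite_V S_subset finite_subset by auto
  have swap: "(\<Sum>w\<in>?H. \<Sum>x\<in>A w. flow x w) = (\<Sum>w\<in>?H. \<Sum>x\<in>A w. flow w x)"
  proof -
    have A: "A w = {x\<in>?H. x \<in> A w}" if "w \<in> ?H" for w using A_in that by blast
    have "(\<Sum>w\<in>?H. \<Sum>x\<in>A w. flow x w) = (\<Sum>w\<in>?H. \<Sum>x\<in>{x\<in>?H. x \<in> A w}. flow x w)"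
      by (intro sum.cong refl A)
    also have "\<dots> = (\<Sum>x\<in>?H. \<Sum>w\<in>{w\<in>?H. x \<in> A w}. flow x w)"
      by (rule sum.swap_restrict[OF finH(1) finH(1)])
    also have "\<dots> = (\<Sum>x\<in>?H. \<Sum>w\<in>A x. flow x w)"
      by (intro sum.cong refl) (use A_sym A_in in blast)
    finally show ?thesis .
  qed
  have "(\<Sum>w\<in>?H. \<Sum>x\<in>A w. flow w x) \<le> (\<Sum>w\<in>?H. charge w + (\<Sum>x\<in>A w. flow x w))"
  proof (rule sum_mono)
    show "(\<Sum>x\<in>A w. flow w x) \<le> charge w + (\<Sum>x\<in>A w. flow x w)" if "w \<in> ?H" for w
      using high_charge[OF that] low_charge[OF that] by linarith
  qed
  then have nonneg: "0 \<le> (\<Sum>w\<in>?H. charge w)" using swap by (simp add: sum.distrib)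
  have "(\<Sum>u\<in>S. \<Sum>w\<in>N u. pay w u) = (\<Sum>u\<in>S. \<Sum>w\<in>{w\<in>?H. u \<in> B w}. pay w u)"
  proof (intro sum.cong refl)
    fix u assume u: "u \<in> S"
    then have "N u \<subseteq> V" "N u \<inter> S = {}" using S_subset N_subset S_indep by auto
    then show "N u = {w\<in>?H. u \<in> B w}" using u N_sym unfolding B_def by blast
  qed
  also have "\<dots> = (\<Sum>w\<in>?H. \<Sum>u\<in>{u\<in>S. u \<in> B w}. pay w u)"
    by (rule sum.swap_restrict[OF finH(2,1)])
  also have "\<dots> = (\<Sum>w\<in>?H. \<Sum>u\<in>B w. pay w u)"
    by (intro sum.cong refl) (auto simp: B_def)
  finally have pay: "(\<Sum>u\<in>S. \<Sum>w\<in>N u. pay w u) = (\<Sum>w\<in>?H. \<Sum>u\<in>B w. pay w u)" .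
  have "(\<Sum>v\<in>V. 8 * int (card (N v)) - 24 - 2 * \<tau> v)
      = (\<Sum>v\<in>?H. 8 * int (card (N v)) - 24 - 2 * \<tau> v) + (\<Sum>v\<in>S. 8 * int (card (N v)) - 24 - 2 * \<tau> v)"
    by (rule sum.subset_diff[OF S_subset finite_V])
  also have "(\<Sum>v\<in>S. 8 * int (card (N v)) - 24 - 2 * \<tau> v) = - (\<Sum>w\<in>?H. \<Sum>u\<in>B w. pay w u)"
    unfolding pay[symmetric] by (simp add: S_charge flip: sum_negf)
  also have "(\<Sum>v\<in>?H. 8 * int (card (N v)) - 24 - 2 * \<tau> v) + - (\<Sum>w\<in>?H. \<Sum>u\<in>B w. pay w u)
      = (\<Sum>w\<in>?H. charge w)"
    unfolding sum_negf[symmetric] sum.distrib[symmetric] by (intro sum.cong refl) (simp add: charge_eq sum_negf)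
  finally show ?thesis using nonneg by simp
qed

end

section \<open>Peeling\<close>

definition nb :: "'a set set \<Rightarrow> 'a \<Rightarrow> 'a set" where
  "nb E v = {u. {u, v} \<in> E}"

definition nb2 :: "'a set set \<Rightarrow> 'a \<Rightarrow> 'a set" where
  "nb2 E v = {u. u \<noteq> v \<and> (u \<in> nb E v \<or> nb E u \<inter> nb E v \<noteq> {})}"

definition no_4_5_cycles :: "'a set set \<Rightarrow> bool" where
  "no_4_5_cycles E \<longleftrightarrow> (\<forall>D. D \<subseteq> E \<longrightarrow> cyc D \<longrightarrow> card D = 3 \<or> 6 \<le> card D)"

lemma nb_sym: "u \<in> nb E v \<Longrightarrow> v \<in> nb E u"
  by (simp add: nb_def insert_commute)

lemma nb_plane:
  assumes "plane V E p \<gamma>" "u \<in> nb E v"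
  shows "u \<in> V" "v \<in> V" "u \<noteq> v"
proof -
  have "{u, v} \<subseteq> V" "card {u, v} = 2" using assms by (auto simp: plane_def nb_def)
  then show "u \<in> V" "v \<in> V" "u \<noteq> v" by auto
qed

lemma nb_finite: "plane V E p \<gamma> \<Longrightarrow> finite (nb E v)"
  using nb_plane(1) plane_finite by (metis finite_subset subsetI)

lemma nb2_finite: "plane V E p \<gamma> \<Longrightarrow> finite (nb2 E v)"
proof -
  assume pl: "plane V E p \<gamma>"
  have "nb2 E v \<subseteq> V" using nb_plane[OF pl] by (auto simp: nb2_def)
  then show ?thesis using plane_finite[OF pl] finite_subset by blast
qed

section \<open>Double counting of edges and triangles\<close>

lemma handshake:
  assumes "plane V E p \<gamma>"
  shows "(\<Sum>v\<in>V. card (nb E v)) = 2 * card E"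
proof -
  have fin: "finite V" "finite E" using plane_finite[OF assms] by auto
  have edges: "e \<subseteq> V \<and> card e = 2" if "e \<in> E" for e using assms that by (auto simp: plane_def)
  have "card (nb E v) = (\<Sum>e\<in>{e\<in>E. v \<in> e}. 1)" for v
  proof -
    have "bij_betw (\<lambda>u. {u, v}) (nb E v) {e\<in>E. v \<in> e}"
    proof (rule bij_betwI')
      show "({u, v} = {u', v}) = (u = u')" for u u' by (auto simp: doubleton_eq_iff)
      show "\<exists>u\<in>nb E v. e = {u, v}" if e: "e \<in> {e\<in>E. v \<in> e}" for e
      proof -
        obtain x y where "e = {x, y}" using edges e by (metis (no_types, lifting) card_2_iff mem_Collect_eq)
        then show ?thesis using e by (auto simp: nb_def insert_commute)
      qed
    qed (simp add: nb_def)
    then show ?thesis by (simp add: bij_betw_same_card)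
  qed
  then have "(\<Sum>v\<in>V. card (nb E v)) = (\<Sum>v\<in>V. \<Sum>e\<in>{e\<in>E. v \<in> e}. 1)" by simp
  also have "\<dots> = (\<Sum>e\<in>E. \<Sum>v\<in>{v\<in>V. v \<in> e}. 1)" by (rule sum.swap_restrict[OF fin])
  also have "\<dots> = (\<Sum>e\<in>E. 2)"
  proof (intro sum.cong refl)
    fix e assume "e \<in> E"
    then have "{v\<in>V. v \<in> e} = e" "card e = 2" using edges by auto
    then show "(\<Sum>v\<in>{v\<in>V. v \<in> e}. 1 :: nat) = 2" by simp
  qed
  finally show ?thesis by simp
qed

lemma triangle_at:
  assumes "D \<in> triangles E" "v \<in> \<Union>D"
  obtains x y where "x \<noteq> y" "D = {{v, x}, {x, y}, {y, v}}"
proof -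
  have D: "cyc D" "card D = 3" using assms by (auto simp: triangles_def)
  then obtain c where c: "distinct c" "3 \<le> length c" "D = insert {last c, hd c} (path_edges c)"
    by (auto simp: cyc_def)
  have U: "\<Union>D = set c" using cyc_Union[OF c(1,2)] c(3) by simp
  then have "length c = 3" using cyc_card_Union[OF D(1)] D(2) distinct_card[OF c(1)] by simp
  then obtain x y z where xyz: "c = [x, y, z]" by (auto simp: numeral_3_eq_3 length_Suc_conv)
  have "v = x \<or> v = y \<or> v = z" using assms(2) U xyz by auto
  moreover have "D = {{x, y}, {y, z}, {z, x}}" "x \<noteq> y" "y \<noteq> z" "z \<noteq> x" using c xyz by auto
  then have "D = {{y, z}, {z, x}, {x, y}}" "D = {{z, x}, {x, y}, {y, z}}" by blast+
  ultimately show ?thesis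
    using that[of y z] that[of z x] that[of x y] \<open>D = {{x, y}, {y, z}, {z, x}}\<close>
      \<open>x \<noteq> y\<close> \<open>y \<noteq> z\<close> \<open>z \<noteq> x\<close> by metis
qed

text \<open>The right side counts ordered pairs of adjacent neighbours of \<open>v\<close>; each
  triangle at \<open>v\<close> supplies two of them, and a pair determines its triangle.\<close>

lemma triangles_at_le:
  assumes "plane V E p \<gamma>"
  shows "2 * card {D\<in>triangles E. v \<in> \<Union>D} \<le> (\<Sum>x\<in>nb E v. card (nb E x \<inter> nb E v))"
proof -
  let ?Q = "SIGMA x:nb E v. nb E x \<inter> nb E v"
  let ?T = "{D\<in>triangles E. v \<in> \<Union>D}"
  let ?P = "\<lambda>D. {q\<in>?Q. {{v, fst q}, {fst q, snd q}, {snd q, v}} = D}"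
  have finQ: "finite ?Q" using nb_finite[OF assms] by auto
  have finT: "finite ?T"
    by (rule finite_subset[of _ "triangles E"]) (use finite_triangles plane_finite[OF assms] in auto)
  have "2 \<le> card (?P D)" if "D \<in> ?T" for D
  proof -
    have D: "D \<in> triangles E" "v \<in> \<Union>D" using that by auto
    then obtain x y where xy: "x \<noteq> y" "D = {{v, x}, {x, y}, {y, v}}" by (rule triangle_at)
    have "D \<subseteq> E" using D(1) by (simp add: triangles_def)
    then have "{(x, y), (y, x)} \<subseteq> ?P D" using xy by (auto simp: nb_def insert_commute)
    moreover have "finite (?P D)" using finQ by auto
    ultimately have "card {(x, y), (y, x)} \<le> card (?P D)" by (rule card_mono[rotated])
    then show ?thesis using xy(1) by simp
  qed
  then have "(\<Sum>D\<in>?T. 2) \<le> (\<Sum>D\<in>?T. card (?P D))" by (rule sum_mono)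
  also have "\<dots> = card (\<Union>D\<in>?T. ?P D)"
    using finT finQ by (intro card_UN_disjoint[symmetric]) auto
  also have "\<dots> \<le> card ?Q" using finQ by (intro card_mono) auto
  also have "\<dots> = (\<Sum>x\<in>nb E v. card (nb E x \<inter> nb E v))"
    using nb_finite[OF assms] by (intro card_SigmaI) auto
  finally show ?thesis by simp
qed

lemma triangles_le:
  assumes "plane V E p \<gamma>"
  shows "6 * card (triangles E) \<le> (\<Sum>v\<in>V. \<Sum>x\<in>nb E v. card (nb E x \<inter> nb E v))"
proof -
  have fin: "finite V" "finite (triangles E)" using plane_finite[OF assms] finite_triangles by auto
  have "(\<Sum>v\<in>V. card {D\<in>triangles E. v \<in> \<Union>D}) = (\<Sum>v\<in>V. \<Sum>D\<in>{D\<in>triangles E. v \<in> \<Union>D}. 1)" by simp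
  also have "\<dots> = (\<Sum>D\<in>triangles E. \<Sum>v\<in>{v\<in>V. v \<in> \<Union>D}. 1)" by (rule sum.swap_restrict[OF fin])
  also have "\<dots> = (\<Sum>D\<in>triangles E. 3)"
  proof (intro sum.cong refl)
    fix D assume D: "D \<in> triangles E"
    have "\<Union>E \<subseteq> V" using assms by (auto simp: plane_def)
    moreover have "D \<subseteq> E" using D by (simp add: triangles_def)
    ultimately have "{v\<in>V. v \<in> \<Union>D} = \<Union>D" by auto
    then show "(\<Sum>v\<in>{v\<in>V. v \<in> \<Union>D}. 1 :: nat) = 3"
      using cyc_card_Union[of D] D by (simp add: triangles_def)
  qed
  finally have "6 * card (triangles E) = (\<Sum>v\<in>V. 2 * card {D\<in>triangles E. v \<in> \<Union>D})"
    by (simp flip: sum_distrib_left)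
  also have "\<dots> \<le> (\<Sum>v\<in>V. \<Sum>x\<in>nb E v. card (nb E x \<inter> nb E v))"
    by (intro sum_mono triangles_at_le[OF assms])
  finally show ?thesis .
qed

lemma total_charge_neg:
  assumes "plane V E p \<gamma>" "V \<noteq> {}" "no_4_5_cycles E"
  shows "(\<Sum>v\<in>V. 8 * int (card (nb E v)) - 24 - 2 * (\<Sum>x\<in>nb E v. int (card (nb E x \<inter> nb E v)))) < 0"
proof -
  have "4 * card E + 6 \<le> 6 * card V + 3 * card (triangles E)"
    using plane_bounds[OF assms(1,2)] assms(3) unfolding no_4_5_cycles_def by blast
  moreover have "6 * int (card (triangles E)) \<le> (\<Sum>v\<in>V. \<Sum>x\<in>nb E v. int (card (nb E x \<inter> nb E v)))"
    using triangles_le[OF assms(1)] by (simp flip: of_nat_sum)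
  moreover have "(\<Sum>v\<in>V. int (card (nb E v))) = 2 * int (card E)"
    using handshake[OF assms(1)] by (simp flip: of_nat_sum)
  ultimately show ?thesis
    by (simp add: sum_subtractf flip: sum_distrib_left)
qed

text \<open>Two common neighbours \<open>x\<close> and \<open>y\<close> would close the 4-cycle u,
  x, v, y.\<close>

lemma one_common_neighbour:
  assumes pl: "plane V E p \<gamma>" and "no_4_5_cycles E" "u \<in> nb E v"
  shows "card (nb E u \<inter> nb E v) \<le> 1"
proof (rule ccontr)
  assume "\<not> ?thesis"
  moreover have "finite (nb E u \<inter> nb E v)" using nb_finite[OF pl] by blast
  ultimately obtain x y where xy: "x \<noteq> y" "x \<in> nb E u" "x \<in> nb E v" "y \<in> nb E u" "y \<in> nb E v"
    using card_le_Suc0_iff_eq[of "nb E u \<inter> nb E v"] by auto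
  let ?c = "[u, x, v, y]"
  let ?D = "insert {last ?c, hd ?c} (path_edges ?c)"
  have dist: "distinct ?c" using xy assms(3) nb_plane(3)[OF pl] by auto
  then have c: "cyc ?D" unfolding cyc_def by (intro exI[of _ ?c]) simp
  have "\<Union>?D = {u, x, v, y}" by auto
  then have "card (\<Union>?D) = 4" using dist by simp
  then have 4: "card ?D = 4" using cyc_card_Union[OF c] by simp
  have "?D \<subseteq> E" using xy by (auto simp: nb_def insert_commute)
  then have "card ?D = 3 \<or> 6 \<le> card ?D" using c assms(2) unfolding no_4_5_cycles_def by blast
  then show False unfolding 4 by simp
qed

section \<open>Orders that end in a peelable list\<close>

definition good_order :: "'a set set \<Rightarrow> nat \<Rightarrow> 'a list \<Rightarrow> bool" where
  "good_order E K vs \<longleftrightarrow> (\<forall>as v bs. vs = as @ v # bs \<longrightarrow>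
     card (nb E v \<inter> set as) \<le> 3 \<and> card (nb2 E v \<inter> set as) \<le> K)"

text \<open>A list that can be placed at the end of every order, whatever precedes it.\<close>

definition peelable :: "'a set set \<Rightarrow> nat \<Rightarrow> 'a list \<Rightarrow> bool" where
  "peelable E K ss \<longleftrightarrow> (\<forall>as v bs. ss = as @ v # bs \<longrightarrow>
     card (nb E v - set bs) \<le> 3 \<and> card (nb2 E v - set bs) \<le> K)"

lemma peelable_Cons:
  assumes "peelable E K ss" "card (nb E v - set ss) \<le> 3" "card (nb2 E v - set ss) \<le> K"
  shows "peelable E K (v # ss)"
  unfolding peelable_def
proof (intro allI impI)
  fix as w bs assume eq: "v # ss = as @ w # bs"
  show "card (nb E w - set bs) \<le> 3 \<and> card (nb2 E w - set bs) \<le> K"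
  proof (cases as)
    case Nil
    then show ?thesis using assms(2,3) eq by simp
  next
    case (Cons a as')
    then have "ss = as' @ w # bs" using eq by simp
    then show ?thesis using assms(1) unfolding peelable_def by blast
  qed
qed

text \<open>An order of the reduced graph may contain peeled vertices; they are dropped and appended
  in the order of \<open>ss\<close>. Dropping only shrinks the sets of earlier vertices, and
  \<open>keep\<close> carries the bounds back to \<open>E\<close>.\<close>

lemma good_order_extend:
  assumes pl: "plane V E p \<gamma>" and ss: "peelable E K ss" "distinct ss" "set ss \<subseteq> V"
    and vs: "good_order E' K vs" "distinct vs" "set vs \<subseteq> V" "V - set ss \<subseteq> set vs"
    and keep: "\<And>v. v \<in> V - set ss \<Longrightarrow> nb E v - set ss \<subseteq> nb E' v \<and> nb2 E v - set ss \<subseteq> nb2 E' v"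
  shows "\<exists>vs. distinct vs \<and> set vs = V \<and> good_order E K vs"
proof -
  let ?f = "filter (\<lambda>v. v \<notin> set ss) vs"
  have good: "card (nb E v \<inter> set as) \<le> 3 \<and> card (nb2 E v \<inter> set as) \<le> K"
    if eq: "?f @ ss = as @ v # bs" for as v bs
  proof -
    consider us where "as = ?f @ us" "ss = us @ v # bs" | us where "?f = as @ v # us"
    proof -
      obtain us where "?f @ us = as \<and> ss = us @ v # bs \<or> ?f = as @ us \<and> us @ ss = v # bs"
        using eq unfolding append_eq_append_conv2 by auto
      then show thesis
      proof (elim disjE conjE)
        assume "?f @ us = as" "ss = us @ v # bs"
        then show thesis using that(1) by blast
      next
        assume *: "?f = as @ us" "us @ ss = v # bs"
        show thesis
        proof (cases us)
          case Nil
          then show ?thesis using * that(1)[of "[]"] by auto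
        next
          case (Cons u us')
          then show ?thesis using * that(2)[of us'] by auto
        qed
      qed
    qed
    then show ?thesis
    proof cases
      case (1 us)
      have "distinct (as @ v # bs)" unfolding eq[symmetric] using vs(2) ss(2) by auto
      then have "set as \<inter> set bs = {}" by auto
      then have "nb E v \<inter> set as \<subseteq> nb E v - set bs" "nb2 E v \<inter> set as \<subseteq> nb2 E v - set bs" by auto
      then have "card (nb E v \<inter> set as) \<le> card (nb E v - set bs)"
        "card (nb2 E v \<inter> set as) \<le> card (nb2 E v - set bs)"
        using nb_finite[OF pl] nb2_finite[OF pl] by (auto intro!: card_mono)
      moreover have "card (nb E v - set bs) \<le> 3 \<and> card (nb2 E v - set bs) \<le> K"
        using ss(1) 1(2) unfolding peelable_def by blast
      ultimately show ?thesis by linarith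
    next
      case (2 us)
      then have "v \<in> set ?f" by simp
      then have v: "v \<in> V - set ss" "v \<in> set vs" using vs(3) by auto
      obtain as' cs where r: "vs = as' @ v # cs" using v(2) by (metis split_list)
      then have "v \<notin> set as'" "v \<notin> set cs" using vs(2) by auto
      moreover have "?f = filter (\<lambda>v. v \<notin> set ss) as' @ v # filter (\<lambda>v. v \<notin> set ss) cs"
        using r v(1) by simp
      ultimately have as: "as = filter (\<lambda>v. v \<notin> set ss) as'"
        using 2 append_Cons_eq_iff[of v "filter (\<lambda>v. v \<notin> set ss) as'" "filter (\<lambda>v. v \<notin> set ss) cs" as us]
        by auto
      have sub: "set as \<subseteq> set as'" "set as \<inter> set ss = {}" using as by auto
      then have "nb E v \<inter> set as \<subseteq> nb E' v \<inter> set as'" "nb2 E v \<inter> set as \<subseteq> nb2 E' v \<inter> set as'"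
        using keep[OF v(1)] by blast+
      then have "card (nb E v \<inter> set as) \<le> card (nb E' v \<inter> set as')"
        "card (nb2 E v \<inter> set as) \<le> card (nb2 E' v \<inter> set as')"
        by (auto intro!: card_mono)
      moreover have "card (nb E' v \<inter> set as') \<le> 3 \<and> card (nb2 E' v \<inter> set as') \<le> K"
        using vs(1) r unfolding good_order_def by blast
      ultimately show ?thesis by linarith
    qed
  qed
  have "distinct (?f @ ss)" using vs(2) ss(2) by auto
  moreover have "set (?f @ ss) = V" using vs(3,4) ss(3) by auto
  ultimately show ?thesis using good unfolding good_order_def by blast
qed

lemma peelable_maximal:
  assumes "finite V"
  obtains ss where "peelable E K ss" "distinct ss" "set ss \<subseteq> V"
    "\<And>v. v \<in> V - set ss \<Longrightarrow> card (nb E v - set ss) \<le> 3 \<Longrightarrow> K < card (nb2 E v - set ss)"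
proof -
  let ?P = "\<lambda>ss. peelable E K ss \<and> distinct ss \<and> set ss \<subseteq> V"
  have "\<exists>ss. ?P ss \<and> (\<forall>ss'. ?P ss' \<longrightarrow> length ss' \<le> length ss)"
  proof (rule ex_has_greatest_nat)
    show "?P []" by (simp add: peelable_def)
    show "\<forall>ss. ?P ss \<longrightarrow> length ss < Suc (card V)"
    proof (intro allI impI)
      fix ss assume "?P ss"
      then have "card (set ss) = length ss" "card (set ss) \<le> card V"
        using card_mono[OF assms] distinct_card[of ss] by blast+
      then show "length ss < Suc (card V)" by simp
    qed
  qed
  then obtain ss where ss: "?P ss" and max: "\<And>ss'. ?P ss' \<Longrightarrow> length ss' \<le> length ss" by blast
  have "K < card (nb2 E v - set ss)" if "v \<in> V - set ss" "card (nb E v - set ss) \<le> 3" for v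
  proof (rule ccontr)
    assume "\<not> ?thesis"
    then have "peelable E K (v # ss)" using peelable_Cons ss that(2) by (metis not_less)
    then show False using max[of "v # ss"] ss that(1) by auto
  qed
  then show ?thesis using that ss by blast
qed

lemma no_4_5_cycles_mono: "no_4_5_cycles E \<Longrightarrow> E' \<subseteq> E \<Longrightarrow> no_4_5_cycles E'"
  unfolding no_4_5_cycles_def by blast

lemma nb_mono: "E' \<subseteq> E \<Longrightarrow> nb E' v \<subseteq> nb E v"
  by (auto simp: nb_def)

theorem good_order_exists:
  assumes "plane V E p \<gamma>" "no_4_5_cycles E" "\<forall>v\<in>V. card (nb E v) \<le> M" "32 \<le> M"
  shows "\<exists>vs. distinct vs \<and> set vs = V \<and> good_order E (M + 2) vs"
  using assms(1-3)
proof (induction "card V + card E" arbitrary: V E rule: less_induct)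
  case less
  note pl = less.prems(1)
  have fin: "finite V" "finite E" using plane_finite[OF pl] by auto
  obtain ss where ss: "peelable E (M + 2) ss" "distinct ss" "set ss \<subseteq> V"
    and max: "\<And>v. v \<in> V - set ss \<Longrightarrow> card (nb E v - set ss) \<le> 3 \<Longrightarrow> M + 2 < card (nb2 E v - set ss)"
    using peelable_maximal[OF fin(1)] by metis
  let ?S = "set ss"
  \<comment> \<open>The smaller graph may be peeled quite differently; only the order it induces on
    the vertices outside \<open>?S\<close> is used.\<close>
  have reduce: ?case
    if sub: "V' \<subseteq> V" "E' \<subseteq> E" and smaller: "card V' + card E' < card V + card E"
      and rest: "V - ?S \<subseteq> V'" and ends: "\<And>e. e \<in> E' \<Longrightarrow> e \<subseteq> V'"
      and keep: "\<And>v. v \<in> V - ?S \<Longrightarrow> nb E v - ?S \<subseteq> nb E' v \<and> nb2 E v - ?S \<subseteq> nb2 E' v" for V' E'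
  proof -
    have "plane V' E' p \<gamma>" using plane_subgraph[OF pl sub ends] .
    moreover have "no_4_5_cycles E'" using no_4_5_cycles_mono less.prems(2) sub(2) by blast
    moreover have "\<forall>v\<in>V'. card (nb E' v) \<le> M"
      using card_mono[OF nb_finite[OF pl] nb_mono[OF sub(2)]] less.prems(3) sub(1)
      by (meson order_trans subsetD)
    ultimately obtain vs where "distinct vs" "set vs = V'" "good_order E' (M + 2) vs"
      using less.hyps[OF smaller] by blast
    then show ?case using good_order_extend[OF pl ss, of E' vs] sub(1) rest keep by blast
  qed
  show ?case
  proof (cases "\<exists>u\<in>?S. \<exists>v\<in>?S. {u, v} \<in> E")
    case True
    then obtain u v where uv: "u \<in> ?S" "v \<in> ?S" "{u, v} \<in> E" by blast
    let ?E = "E - {{u, v}}"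
    have kept: "{x, y} \<in> ?E" if "{x, y} \<in> E" "x \<notin> ?S \<or> y \<notin> ?S" for x y
      using that uv by (auto simp: doubleton_eq_iff)
    show ?thesis
    proof (rule reduce[of V ?E])
      show "card V + card ?E < card V + card E" using card_Diff1_less[OF fin(2) uv(3)] by simp
      show "e \<subseteq> V" if "e \<in> ?E" for e using that pl by (auto simp: plane_def)
      have nb_kept: "nb E y \<subseteq> nb ?E y" if "y \<notin> ?S" for y
        using kept that unfolding nb_def by blast
      show "nb E w - ?S \<subseteq> nb ?E w \<and> nb2 E w - ?S \<subseteq> nb2 ?E w" if w: "w \<in> V - ?S" for w
      proof (intro conjI subsetI)
        show "x \<in> nb ?E w" if "x \<in> nb E w - ?S" for x using nb_kept[of w] w that by blast
        show "x \<in> nb2 ?E w" if "x \<in> nb2 E w - ?S" for x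
          using nb_kept[of w] nb_kept[of x] w that unfolding nb2_def by blast
      qed
    qed auto
  next
    case no_edge: False
    show ?thesis
    \<comment> \<open>Degrees 0 and 1 satisfy the condition vacuously, so in the other case every
      vertex of \<open>?S\<close> has degree at least 2.\<close>
    proof (cases "\<exists>u\<in>?S. \<forall>x\<in>nb E u. \<forall>y\<in>nb E u. x \<noteq> y \<longrightarrow> {x, y} \<in> E")
      case True
      then obtain u where u: "u \<in> ?S" "\<And>x y. x \<in> nb E u \<Longrightarrow> y \<in> nb E u \<Longrightarrow> x \<noteq> y \<Longrightarrow> {x, y} \<in> E"
        by blast
      let ?V = "V - {u}" and ?E = "{e\<in>E. u \<notin> e}"
      show ?thesis
      proof (rule reduce[of ?V ?E])
        have "card ?V < card V" using card_Diff1_less[OF fin(1)] u(1) ss(3) by blast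
        moreover have "card ?E \<le> card E" using fin by (intro card_mono) auto
        ultimately show "card ?V + card ?E < card V + card E" by linarith
        show "e \<subseteq> ?V" if "e \<in> ?E" for e using that pl by (auto simp: plane_def)
        show "nb E w - ?S \<subseteq> nb ?E w \<and> nb2 E w - ?S \<subseteq> nb2 ?E w" if w: "w \<in> V - ?S" for w
        proof
          show 1: "nb E w - ?S \<subseteq> nb ?E w" using u(1) w by (auto simp: nb_def)
          show "nb2 E w - ?S \<subseteq> nb2 ?E w"
          proof
            fix x assume x: "x \<in> nb2 E w - ?S"
            then have ne: "x \<noteq> w" "x \<notin> ?S" by (auto simp: nb2_def)
            show "x \<in> nb2 ?E w"
            proof (cases "x \<in> nb E w")
              case True
              then show ?thesis using 1 ne by (auto simp: nb2_def)
            next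
              case False
              then obtain z where z: "z \<in> nb E x" "z \<in> nb E w" using x by (auto simp: nb2_def)
              \<comment> \<open>If \<open>u\<close> were the link, its neighbours \<open>x\<close>
                and \<open>w\<close> would be adjacent already.\<close>
              have "z \<noteq> u"
              proof
                assume "z = u"
                then have "x \<in> nb E u" "w \<in> nb E u" using z nb_sym by metis+
                from u(2)[OF this ne(1)] show False using False by (simp add: nb_def)
              qed
              then have "z \<in> nb ?E x" "z \<in> nb ?E w" using z u(1) w ne by (auto simp: nb_def)
              then show ?thesis using ne(1) by (auto simp: nb2_def)
            qed
          qed
        qed
      qed (use u(1) in auto)
    next
      case no_simplicial: False
      have small: "card (nb E u) \<le> 3" if u: "u \<in> ?S" for u
      proof -
        obtain as bs where ab: "ss = as @ u # bs" using u by (metis split_list)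
        then have "card (nb E u - set bs) \<le> 3" using ss(1) unfolding peelable_def by blast
        \<comment> \<open>By independence no neighbour of \<open>u\<close> lies in
          \<open>bs\<close>, so the bound 3 holds for its full degree.\<close>
        moreover have "nb E u - set bs = nb E u" using no_edge u ab by (auto simp: nb_def)
        ultimately show ?thesis by simp
      qed
      have "peeled_graph V ?S (nb E) M"
      proof
        show "finite V" by fact
        show "nb E v \<subseteq> V" for v using nb_plane(1)[OF pl] by blast
        show "v \<in> nb E u" if "u \<in> nb E v" for u v using nb_sym that by metis
        show "v \<notin> nb E v" for v using nb_plane(3)[OF pl] by blast
        show "card (nb E u \<inter> nb E v) \<le> 1" if "u \<in> nb E v" for u v
          using one_common_neighbour[OF pl less.prems(2) that] .
        show "card (nb E v) \<le> M" if "v \<in> V" for v using less.prems(3) that by blast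
        show "32 \<le> M" by fact
        show "?S \<subseteq> V" by fact
        show "nb E u \<inter> ?S = {}" if "u \<in> ?S" for u using no_edge that by (auto simp: nb_def)
        show "card (nb E u) = 2 \<and> (\<forall>w\<in>nb E u. nb E u \<inter> nb E w = {}) \<or> card (nb E u) = 3" if u: "u \<in> ?S" for u
        proof -
          obtain x y where xy: "x \<in> nb E u" "y \<in> nb E u" "x \<noteq> y" "{x, y} \<notin> E"
            using no_simplicial u by blast
          have "card {x, y} \<le> card (nb E u)" using xy nb_finite[OF pl] by (intro card_mono) auto
          then have "card (nb E u) = 2 \<or> card (nb E u) = 3" using small[OF u] xy(3) by auto
          moreover have "\<forall>w\<in>nb E u. nb E u \<inter> nb E w = {}" if "card (nb E u) = 2"
          proof -
            have "nb E u = {x, y}"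
              using xy that nb_finite[OF pl] by (intro card_subset_eq[symmetric]) auto
            moreover have "x \<notin> nb E x" "y \<notin> nb E y" using nb_plane(3)[OF pl] by blast+
            moreover have "x \<notin> nb E y" "y \<notin> nb E x" using xy(4) by (auto simp: nb_def insert_commute)
            ultimately show ?thesis by auto
          qed
          ultimately show ?thesis by blast
        qed
        show "M + 3 \<le> card ({u. u \<noteq> w \<and> (u \<in> nb E w \<or> nb E u \<inter> nb E w \<noteq> {})} - ?S)"
          if "w \<in> V - ?S" "card (nb E w - ?S) \<le> 3" for w
          using max[OF that] by (simp add: nb2_def)
      qed
      then interpret peeled_graph V ?S "nb E" M .
      \<comment> \<open>The total charge is nonnegative by discharging and negative by the density
        bound, which holds for every graph with a vertex.\<close>
      have "V = {}"
        using total_charge_nonneg total_charge_neg[OF pl _ less.prems(2)] unfolding \<tau>_def by linarith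
      then show ?thesis by (intro exI[of _ "[]"]) (simp add: good_order_def)
    qed
  qed
qed

section \<open>The theorem for pair graphs\<close>

definition edge_set :: "'a pair_pre_digraph \<Rightarrow> 'a set set" where
  "edge_set G = (\<lambda>(u, v). {u, v}) ` parcs G"

fun path_arcs :: "'a list \<Rightarrow> ('a \<times> 'a) list" where
  "path_arcs (x # y # zs) = (x, y) # path_arcs (y # zs)"
| "path_arcs _ = []"

context pair_graph
begin

lemma edge_set_iff: "{u, v} \<in> edge_set G \<longleftrightarrow> (u, v) \<in> parcs G"
proof -
  have "(v, u) \<in> parcs G" if "(u, v) \<in> parcs G" for u v
    using pair_sym_arcs that by (auto simp: symmetric_def dest: symD)
  then show ?thesis by (auto simp: edge_set_def doubleton_eq_iff image_iff split: prod.splits)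
qed

lemma parcs_ends: "(u, v) \<in> parcs G \<Longrightarrow> u \<in> pverts G \<and> v \<in> pverts G \<and> u \<noteq> v"
  using wellformed' pair_no_loops[of "(u, v)"] by auto

lemma finite_pverts: "finite (pverts G)"
  by (rule pair_finite_verts)

lemma nb_edge_set: "nb (edge_set G) v = {u. (v, u) \<in> parcs G}"
  by (simp add: nb_def insert_commute flip: edge_set_iff)

lemma path_arcs:
  assumes "xs \<noteq> []" "path_edges xs \<subseteq> edge_set G"
  shows "pcas (hd xs) (path_arcs xs) (last xs) \<and> pawalk_verts (hd xs) (path_arcs xs) = xs \<and>
    length (path_arcs xs) = length xs - 1 \<and> set (path_arcs xs) \<subseteq> parcs G"
  using assms by (induction xs rule: path_arcs.induct) (auto simp: edge_set_iff)

lemma cyc_cycle: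
  assumes "cyc D" "D \<subseteq> edge_set G"
  shows "contains_cycle_of_length G (card D)"
proof -
  obtain c where c: "distinct c" "3 \<le> length c" "D = insert {last c, hd c} (path_edges c)"
    using assms(1) by (auto simp: cyc_def)
  let ?c = "c @ [hd c]"
  have ne: "c \<noteq> []" using c(2) by auto
  then have D: "path_edges ?c = D" using c(3) by (simp add: path_edges_append)
  have len: "length c = card D"
    using cyc_card_Union[OF assms(1)] cyc_Union[OF c(1,2)] c(3) distinct_card[OF c(1)] by simp
  have p: "pcas (hd ?c) (path_arcs ?c) (last ?c)" "pawalk_verts (hd ?c) (path_arcs ?c) = ?c"
    "length (path_arcs ?c) = length ?c - 1" "set (path_arcs ?c) \<subseteq> parcs G"
    using path_arcs[of ?c] D assms(2) by auto
  have "hd c \<in> pverts G"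
  proof -
    obtain x y zs where "c = x # y # zs" using c(2) by (cases c rule: path_edges.cases) auto
    then have "(x, y) \<in> parcs G" using c(3) assms(2) by (auto simp: edge_set_iff)
    then show ?thesis using \<open>c = x # y # zs\<close> wellformed' by auto
  qed
  then have "awalk (hd c) (path_arcs ?c) (hd c)" using p ne by (simp add: awalk_def)
  moreover have "distinct (tl (pawalk_verts (hd c) (path_arcs ?c)))"
    using p(2) ne c(1) by (cases c) auto
  moreover have "path_arcs ?c \<noteq> []" using p(3) c(2) by auto
  ultimately have "cycle (path_arcs ?c)" unfolding cycle_def by auto
  then show ?thesis using p(3) len unfolding contains_cycle_of_length_def by auto
qed

lemma no_4_5_cycles_edge_set:
  assumes "\<not> contains_cycle_of_length G 4" "\<not> contains_cycle_of_length G 5"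
  shows "no_4_5_cycles (edge_set G)"
  unfolding no_4_5_cycles_def
proof (intro allI impI)
  fix D assume D: "D \<subseteq> edge_set G" "cyc D"
  have "card D \<noteq> 4" "card D \<noteq> 5" using cyc_cycle[OF D(2,1)] assms by auto
  then show "card D = 3 \<or> 6 \<le> card D" using cyc_card_Union[OF D(2)] by linarith
qed

lemma card_nb_le: "v \<in> pverts G \<Longrightarrow> card (nb (edge_set G) v) \<le> max_degree G"
proof -
  assume v: "v \<in> pverts G"
  have "out_arcs G v = Pair v ` nb (edge_set G) v"
    by (auto simp: nb_edge_set)
  then have "out_degree G v = card (nb (edge_set G) v)"
    by (simp add: out_degree_def card_image inj_on_def)
  then have "card (nb (edge_set G) v) \<in> insert 0 (out_degree G ` pverts G)" using v by (metis image_eqI insertI2)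
  then show ?thesis unfolding max_degree_def using pair_finite_verts by (intro Max_ge) auto
qed

lemma square_arc:
  assumes "(u, v) \<in> parcs (graph_square G)"
  shows "u \<in> nb2 (edge_set G) v"
proof (cases "(u, v) \<in> parcs G")
  case True
  then show ?thesis using pair_no_loops[of "(u, v)"] by (auto simp: nb2_def nb_def edge_set_iff)
next
  case False
  then have uv: "u \<in> pverts G" "\<mu> (\<lambda>_. 1) u v = 2"
    using assms by (auto simp: graph_square_def graph_dist_def)
  have "u \<noteq> v"
  proof
    assume "u = v"
    then have "awalk u [] v" using uv(1) by (simp add: awalk_def)
    from min_cost_le_walk_cost[OF this, of "\<lambda>_. 1"] show False using uv(2) by simp
  qed
  \<comment> \<open>\<open>\<mu>\<close> is an infimum of walk costs; the strict bound 3 turns it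
    into an actual walk of at most two arcs.\<close>
  have "\<mu> (\<lambda>_. 1) u v < 3" using uv(2) by simp
  then obtain p where p: "awalk u p v" "ereal (awalk_cost (\<lambda>_. 1) p) < 3"
    unfolding \<mu>_def INF_less_iff by auto
  have "awalk_cost (\<lambda>_. 1) p = real (length p)" by (induction p) auto
  then have "ereal (real (length p)) < ereal 3" using p(2) by simp
  then have "length p < 3" by simp
  then consider "p = []" | e where "p = [e]" | e f where "p = [e, f]"
    by (cases p rule: path_edges.cases) auto
  then show ?thesis
  proof cases
    case 1
    then show ?thesis using p(1) \<open>u \<noteq> v\<close> by (simp add: awalk_def)
  next
    case (2 e)
    then show ?thesis using p(1) False by (cases e) (auto simp: awalk_def)
  next
    case (3 e f)
    then obtain w where "(u, w) \<in> parcs G" "(w, v) \<in> parcs G"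
      using p(1) by (cases e; cases f) (auto simp: awalk_def)
    then have "w \<in> nb (edge_set G) u" "w \<in> nb (edge_set G) v"
      using edge_set_iff nb_edge_set by (auto simp: nb_def)
    then show ?thesis using \<open>u \<noteq> v\<close> by (auto simp: nb2_def)
  qed
qed

end

lemma plane_edge_set:
  assumes "pair_graph G" "plane_drawing G p \<gamma>"
  shows "plane (pverts G) (edge_set G) p \<gamma>"
proof -
  note drawing = assms(2)[unfolded plane_drawing_def]
  have inj: "inj_on p (pverts G)" using drawing by (rule conjunct1)
  have 1: "arc (\<gamma> {u, v}) \<and>
      {pathstart (\<gamma> {u, v}), pathfinish (\<gamma> {u, v})} = {p u, p v} \<and>
      path_image (\<gamma> {u, v}) \<inter> p ` pverts G = {p u, p v}" if "(u, v) \<in> parcs G" for u v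
    using bspec[OF drawing[THEN conjunct2, THEN conjunct1] that] by (simp only: prod.case)
  have 2: "path_image (\<gamma> {u, v}) \<inter> path_image (\<gamma> {x, y}) \<subseteq> p ` ({u, v} \<inter> {x, y})"
    if "(u, v) \<in> parcs G" "(x, y) \<in> parcs G" "{u, v} \<noteq> {x, y}" for u v x y
  proof -
    note bspec[OF drawing[THEN conjunct2, THEN conjunct2] that(1), unfolded prod.case]
    from bspec[OF this that(2), unfolded prod.case] that(3) show ?thesis by (rule mp)
  qed
  show ?thesis
    unfolding plane_def
  proof (intro conjI ballI impI)
    fix e assume "e \<in> edge_set G"
    then obtain u v where e: "e = {u, v}" "(u, v) \<in> parcs G" by (auto simp: edge_set_def)
    note c = 1[OF e(2), folded e(1)]
    show "e \<subseteq> pverts G" "card e = 2" using pair_graph.parcs_ends[OF assms(1) e(2)] e(1) by auto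
    have pe: "p ` e = {p u, p v}" by (simp add: e(1))
    show "arc (\<gamma> e)" using c by (rule conjunct1)
    show "{pathstart (\<gamma> e), pathfinish (\<gamma> e)} = p ` e" unfolding pe by (rule c[THEN conjunct2, THEN conjunct1])
    show "path_image (\<gamma> e) \<inter> p ` pverts G = p ` e" unfolding pe by (rule c[THEN conjunct2, THEN conjunct2])
    fix f assume "f \<in> edge_set G" "e \<noteq> f"
    then show "path_image (\<gamma> e) \<inter> path_image (\<gamma> f) \<subseteq> p ` (e \<inter> f)"
      using 2[OF e(2)] e(1) by (auto simp: edge_set_def)
  qed (use inj pair_graph.finite_pverts[OF assms(1)] in auto)
qed

theorem theorem1p3:
  fixes G :: "'a pair_pre_digraph"
  assumes "pair_graph G"
    and "planar G"
    and "\<not> contains_cycle_of_length G 4"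
    and "\<not> contains_cycle_of_length G 5"
  shows "\<exists>vs. distinct vs \<and> set vs = pverts G \<and>
           (\<forall>i < length vs.
              card (earlier_neighbors G vs i) \<le> 3 \<and>
              card (earlier_neighbors (graph_square G) vs i) \<le> max (max_degree G) 32 + 2)"
proof -
  interpret pair_graph G by fact
  let ?E = "edge_set G"
  obtain p \<gamma> where "plane_drawing G p \<gamma>" using assms(2) by (auto simp: planar_def)
  note pl = plane_edge_set[OF assms(1) this]
  obtain vs where vs: "distinct vs" "set vs = pverts G" "good_order ?E (max (max_degree G) 32 + 2) vs"
    using good_order_exists[OF pl no_4_5_cycles_edge_set[OF assms(3,4)], of "max (max_degree G) 32"] card_nb_le
    by (meson max.cobounded1 max.cobounded2 order_trans)
  have "card (earlier_neighbors G vs i) \<le> 3 \<and>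
      card (earlier_neighbors (graph_square G) vs i) \<le> max (max_degree G) 32 + 2" if "i < length vs" for i
  proof -
    have "vs = take i vs @ vs ! i # drop (Suc i) vs" using id_take_nth_drop[OF that] .
    then have "card (nb ?E (vs ! i) \<inter> set (take i vs)) \<le> 3"
      "card (nb2 ?E (vs ! i) \<inter> set (take i vs)) \<le> max (max_degree G) 32 + 2"
      using vs(3) unfolding good_order_def by blast+
    moreover have "earlier_neighbors G vs i \<subseteq> nb ?E (vs ! i) \<inter> set (take i vs)"
      by (auto simp: earlier_neighbors_def nb_def edge_set_iff)
    then have "card (earlier_neighbors G vs i) \<le> card (nb ?E (vs ! i) \<inter> set (take i vs))"
      by (intro card_mono) auto
    moreover have "earlier_neighbors (graph_square G) vs i \<subseteq> nb2 ?E (vs ! i) \<inter> set (take i vs)"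
      using square_arc by (auto simp: earlier_neighbors_def)
    then have "card (earlier_neighbors (graph_square G) vs i) \<le> card (nb2 ?E (vs ! i) \<inter> set (take i vs))"
      by (intro card_mono) auto
    ultimately show ?thesis by linarith
  qed
  then show ?thesis using vs(1,2) by blast
qed

end
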